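(* Let $1 \le k \le n$ be integers and write $k = \rho n$ with $\rho \in (0,1]$. Let $Q$ be uniformly distributed on the Stiefel manifold $\mathbb{V}_k^n$, and let $G \in \mathbb{M}^{n\times k}$ be a random matrix with independent $\mathrm{N}(0, n^{-1})$ entries. Then for each nonnegative, sublinear, convex function $\lvert\cdot\rvert : \mathbb{M}^{n\times k} \to \mathbb{R}$ and each weakly increasing, convex function $\Phi : \mathbb{R} \to \mathbb{R}$, $$\mathbb{E}\, \Phi(\lvert Q \rvert) \le \mathbb{E}\, \Phi\big((1+\rho/2)\, \lvert G \rvert\big).$$ In particular, for all $k \le n$, $$\mathbb{E}\, \Phi(\lvert Q \rvert) \le \mathbb{E}\, \Phi\big(1.5\, \lvert G \rvert\big).$$
   Context: $\mathbb{M}^{n\times k}$ is the space of real $n\times k$ matrices. The Stiefel manifold is $\mathbb{V}_k^n := \{Q \in \mathbb{M}^{n\times k} : Q^* Q = \mathrm{I}\}$ ($n\times k$ real matrices with orthonormal columns); "uniformly distributed" means distributed according to the Haar probability measure on $\mathbb{V}_k^n$, the one invariant under orthogonal transformations on the left and the right. A convex function is called sublinear when it is positive homogeneous, i.e. $\lvert tA\rvert = t\lvert A\rvert$ for $t > 0$. $\mathrm{N}(0,n^{-1})$ is the centered Gaussian distribution with variance $n^{-1}$. The expectations on the right-hand sides may equal $+\infty$. *)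

theory Defs
  imports "HOL-Probability.Probability"
begin

(* A real n x k matrix is an element of real^'k^'n, with CARD('n) = n rows and CARD('k) = k
   columns. *)

definition stiefel :: "(real ^ 'k ^ 'n) set"
  where "stiefel = {A. transpose A ** A = mat 1}"

(* The law of a random matrix is a Borel measure on the whole matrix space, so a law on the
   Stiefel manifold is a law on matrices that is concentrated there. *)
definition stiefel_haar :: "(real ^ 'k ^ 'n) measure \<Rightarrow> bool"
  where "stiefel_haar \<mu> \<longleftrightarrow>
    prob_space \<mu> \<and> sets \<mu> = sets borel \<and> (AE A in \<mu>. A \<in> stiefel) \<and>
    (\<forall>U :: real ^ 'n ^ 'n. orthogonal_matrix U \<longrightarrow> distr \<mu> borel (\<lambda>A. U ** A) = \<mu>) \<and>
    (\<forall>V :: real ^ 'k ^ 'k. orthogonal_matrix V \<longrightarrow> distr \<mu> borel (\<lambda>A. A ** V) = \<mu>)"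

definition uniform_on_stiefel :: "'a measure \<Rightarrow> ('a \<Rightarrow> real ^ 'k ^ 'n) \<Rightarrow> bool"
  where "uniform_on_stiefel M Q \<longleftrightarrow> Q \<in> borel_measurable M \<and> stiefel_haar (distr M borel Q)"

(* The parameter is the standard deviation, following normal_density, not the variance. *)
definition iid_gaussian_matrix :: "'a measure \<Rightarrow> real \<Rightarrow> ('a \<Rightarrow> real ^ 'k ^ 'n) \<Rightarrow> bool"
  where "iid_gaussian_matrix M \<sigma> G \<longleftrightarrow>
    prob_space.indep_vars M (\<lambda>_. borel) (\<lambda>(i, j) \<omega>. G \<omega> $ i $ j) (UNIV :: ('n \<times> 'k) set) \<and>
    (\<forall>i j. distributed M lborel (\<lambda>\<omega>. G \<omega> $ i $ j) (normal_density 0 \<sigma>))"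

(* The Bochner integral is 0 for non-integrable functions, so expectations that may be infinite
   are taken as E(X+) - E(X-) in the extended reals (ennreal sends negative reals to 0).  This is
   meaningful whenever one of the two parts is finite, for example when X is bounded below. *)
definition ext_expectation :: "'a measure \<Rightarrow> ('a \<Rightarrow> real) \<Rightarrow> ereal"
  where "ext_expectation M X =
    enn2ereal (\<integral>\<^sup>+ \<omega>. ennreal (X \<omega>) \<partial>M) - enn2ereal (\<integral>\<^sup>+ \<omega>. ennreal (- X \<omega>) \<partial>M)"

definition sublinear_convex :: "('v :: real_vector \<Rightarrow> real) \<Rightarrow> bool"
  where "sublinear_convex f \<longleftrightarrow>
    convex_on UNIV f \<and> (\<forall>t A. t > 0 \<longrightarrow> f (t *\<^sub>R A) = t * f A)"

end

theory Submission
  imports Defs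
begin

text \<open>
  Scale \<open>G\<close> to have standard normal entries and factor it by Gram-Schmidt as \<open>Q' S\<close>, where \<open>Q'\<close> is Haar
  distributed and independent of the triangular matrix \<open>S\<close>. Replacing \<open>S\<close> by \<open>P S P\<^sup>T\<close> for a signed
  permutation \<open>P\<close> does not change the law of \<open>Q' S\<close>, and the average over \<open>P\<close> of the expectation of
  \<open>P S P\<^sup>T\<close> is \<open>\<alpha> I\<close> with \<open>\<alpha> = E (tr S) / k\<close>. Jensen's inequality conditionally on \<open>Q'\<close> therefore
  bounds the expectation of \<open>H (\<alpha> Q)\<close> by that of \<open>H (\<surd>n G)\<close> for convex \<open>H\<close>.
  The diagonal entries of \<open>S\<close> are chi distributed with \<open>n, n - 1, \<dots>, n - k + 1\<close> degrees of freedom, and a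
  chi variable with \<open>m\<close> degrees of freedom has mean at least \<open>\<surd>(m - 1/2)\<close>. Concavity of the square root
  turns the sum of these into \<open>2/3 (n\<^bsup>3/2\<^esup> - (n - k)\<^bsup>3/2\<^esup>)\<close>, whence \<open>(1 + \<rho>/2) \<alpha> / \<surd>n \<ge> 1\<close>.
\<close>

section \<open>The mean of the chi distribution\<close>

text \<open>The sublinear function is not assumed invariant under rotations, so Jensen's inequality
  with the mean of \<open>S\<close> alone would produce \<open>Q\<close> times a matrix that is in
  general not scalar; the signed permutations repair exactly this. Haar measure enters only through
  its invariance: the law of the Gram-Schmidt frame is never identified with it. Instead, an
  auxiliary random rotation made from a square Gaussian matrix links the two under Fubini's theorem.
  The chi mean comes from writing \<open>sqrt y\<close> as an integral of
  \<open>y * exp (- s^2 * y)\<close>, so that a recursion in steps of two and a crude asymptotic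
  bound suffice. The shift 1/2 serves twice: it is the smallest one for which the monotonicity
  argument works for all \<open>m\<close>, and it makes \<open>m - 1/2\<close> the midpoint of the
  interval from \<open>m - 1\<close> to \<open>m\<close>, where concavity bounds the mean of the
  square root. Since expectations may be infinite, every comparison is made between nonnegative
  integrals of \<open>\<Phi> - \<Phi> 0\<close>.\<close>

definition sq_normal_laplace :: "real \<Rightarrow> real"
  where "sq_normal_laplace s = 1 / sqrt (1 + 2 * s\<^sup>2)"

text \<open>\<open>sq_normal_laplace s\<close> is the mean of \<open>exp (- s^2 * g^2)\<close> for a
  standard normal \<open>g\<close>; its powers belong to several independent coordinates. In closed
  form the integral is a quotient of gamma values.\<close>

definition chi_integral :: "nat \<Rightarrow> real"
  where "chi_integral p = (\<integral>s. indicator {0..} s * sq_normal_laplace s ^ p \<partial>lborel)"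

lemma one_plus_square_pos: "0 < 1 + 2 * (s::real)\<^sup>2"
  by (rule add_pos_nonneg) auto

lemma sq_normal_laplace_pos: "0 < sq_normal_laplace s" and sq_normal_laplace_le_1: "sq_normal_laplace s \<le> 1"
proof -
  have "1 \<le> 1 + 2 * s\<^sup>2" by simp
  then have "1 \<le> sqrt (1 + 2 * s\<^sup>2)" by simp
  then show "0 < sq_normal_laplace s" "sq_normal_laplace s \<le> 1" unfolding sq_normal_laplace_def using one_plus_square_pos[of s] by (auto simp: divide_le_eq)
qed

lemma sq_normal_laplace_square: "(sq_normal_laplace s)\<^sup>2 = 1 / (1 + 2 * s\<^sup>2)"
proof -
  have "0 < 1 + 2 * s\<^sup>2" by (rule one_plus_square_pos)
  then show ?thesis unfolding sq_normal_laplace_def by (simp add: power_divide)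
qed

lemma sq_normal_laplace_measurable [measurable]: "sq_normal_laplace \<in> borel_measurable borel"
  unfolding sq_normal_laplace_def by measurable

lemma sq_normal_laplace_DERIV: "(sq_normal_laplace has_real_derivative - 2 * s * sq_normal_laplace s ^ 3) (at s)"
proof -
  have pos: "0 < 1 + 2 * s\<^sup>2" by (rule one_plus_square_pos)
  show ?thesis unfolding sq_normal_laplace_def using pos
    by (auto intro!: derivative_eq_intros simp: power2_eq_square power3_eq_cube divide_simps)
qed

text \<open>The square has an arctangent as primitive. It is the smallest usable integer power, as
  the first power decays only like \<open>1 / s\<close>; higher powers are dominated by it.\<close>

lemma integrable_sq_normal_laplace_square: "integrable lborel (\<lambda>s. indicator {0..} s * (sq_normal_laplace s)\<^sup>2)"
proof -
  define F where "F s = arctan (sqrt 2 * s) / sqrt 2" for s :: real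
  have d: "(F has_real_derivative (sq_normal_laplace s)\<^sup>2) (at s)" for s
    unfolding F_def sq_normal_laplace_square
    by (auto intro!: derivative_eq_intros simp: power_mult_distrib divide_simps)
  have lim: "(F \<longlongrightarrow> (pi/2) / sqrt 2) at_top" unfolding F_def
    by (intro tendsto_divide tendsto_const filterlim_compose[OF tendsto_arctan_at_top]) (real_asymp | simp)+
  have "(\<integral>\<^sup>+s. ennreal ((sq_normal_laplace s)\<^sup>2) * indicator {0..} s \<partial>lborel) = ennreal ((pi/2)/sqrt 2 - F 0)"
    by (rule nn_integral_FTC_atLeast[OF _ d _ lim]) auto
  moreover have "(\<integral>\<^sup>+s. ennreal (indicator {0..} s * (sq_normal_laplace s)\<^sup>2) \<partial>lborel) = (\<integral>\<^sup>+s. ennreal ((sq_normal_laplace s)\<^sup>2) * indicator {0..} s \<partial>lborel)"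
    by (intro nn_integral_cong) (auto simp: indicator_def)
  ultimately show ?thesis
    by (intro integrableI_nonneg) auto
qed

lemma integrable_sq_normal_laplace_power:
  assumes "2 \<le> p" shows "integrable lborel (\<lambda>s. indicator {0..} s * sq_normal_laplace s ^ p)"
proof (rule Bochner_Integration.integrable_bound[OF integrable_sq_normal_laplace_square])
  have "sq_normal_laplace s ^ p \<le> (sq_normal_laplace s)\<^sup>2" for s
    using assms sq_normal_laplace_pos[of s] sq_normal_laplace_le_1[of s] by (intro power_decreasing) auto
  then show "AE s in lborel. norm (indicator {0..} s * sq_normal_laplace s ^ p) \<le> norm (indicator {0..} s * (sq_normal_laplace s)\<^sup>2)"
    using sq_normal_laplace_pos by (auto simp: indicator_def abs_of_pos intro!: AE_I2)
qed auto

text \<open>Integrate the derivative of \<open>s * sq_normal_laplace s ^ p\<close> over the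
  half-line. The factor \<open>s\<close> kills the boundary term at 0, and \<open>2 \<le> p\<close>
  gives decay at infinity.\<close>

lemma chi_integral_rec:
  assumes "2 \<le> p"
  shows "(real p - 1) * chi_integral p = real p * chi_integral (p + 2)"
proof -
  define F where "F s = s * sq_normal_laplace s ^ p" for s
  define f where "f s = (1 - real p) * sq_normal_laplace s ^ p + real p * sq_normal_laplace s ^ (p+2)" for s
  have d: "(F has_real_derivative f s) (at s)" for s
  proof -
    have "0 < 1 + 2 * s\<^sup>2" by (rule one_plus_square_pos)
    \<comment> \<open>This identity trades the factor \<open>s^2\<close> produced by differentiation
      for powers of \<open>sq_normal_laplace s\<close>.\<close>
    then have "2 * s\<^sup>2 * (sq_normal_laplace s)\<^sup>2 = 1 - (sq_normal_laplace s)\<^sup>2" unfolding sq_normal_laplace_square by (simp add: divide_simps)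
    then have "2 * s\<^sup>2 * (sq_normal_laplace s)\<^sup>2 * sq_normal_laplace s ^ p * p = (1 - (sq_normal_laplace s)\<^sup>2) * sq_normal_laplace s ^ p * p" by simp
    moreover have "sq_normal_laplace s ^ p = sq_normal_laplace s * sq_normal_laplace s ^ (p - 1)" using assms by (cases p) auto
    ultimately have "sq_normal_laplace s ^ p + s * (real p * (sq_normal_laplace s ^ (p - 1) * (- 2 * s * sq_normal_laplace s ^ 3))) = f s"
      unfolding f_def by (simp add: algebra_simps power2_eq_square power3_eq_cube)
    moreover have "(F has_real_derivative 1 * sq_normal_laplace s ^ p + (real p * sq_normal_laplace s ^ (p - 1) * (- 2 * s * sq_normal_laplace s ^ 3)) * s) (at s)"
      unfolding F_def by (rule derivative_eq_intros sq_normal_laplace_DERIV refl)+ simp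
    ultimately show ?thesis by (simp add: algebra_simps)
  qed
  have int: "integrable lborel (\<lambda>s. indicator {0..} s * sq_normal_laplace s ^ p)" "integrable lborel (\<lambda>s. indicator {0..} s * sq_normal_laplace s ^ (p+2))"
    using assms by (intro integrable_sq_normal_laplace_power; simp)+
  have eqf: "(\<lambda>s. indicator {0..} s * f s) = (\<lambda>s. (1 - real p) * (indicator {0..} s * sq_normal_laplace s ^ p) + real p * (indicator {0..} s * sq_normal_laplace s ^ (p+2)))"
    unfolding f_def by (auto simp: fun_eq_iff algebra_simps)
  have intf: "integrable lborel (\<lambda>s. indicator {0..} s * f s)"
    unfolding eqf using int by auto
  have Fb: "\<bar>F s\<bar> \<le> \<bar>s / (1 + 2 * s\<^sup>2)\<bar>" for s
  proof -
    have "sq_normal_laplace s ^ p \<le> (sq_normal_laplace s)\<^sup>2"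
      using assms sq_normal_laplace_pos[of s] sq_normal_laplace_le_1[of s] by (intro power_decreasing) auto
    then show ?thesis unfolding F_def sq_normal_laplace_square using sq_normal_laplace_pos[of s]
      by (auto simp: abs_mult divide_inverse intro!: mult_left_mono)
  qed
  have lim: "(F \<longlongrightarrow> 0) at_top"
    proof (rule Lim_null_comparison[OF always_eventually])
    show "\<forall>s. norm (F s) \<le> \<bar>s / (1 + 2 * s\<^sup>2)\<bar>" using Fb by auto
  qed real_asymp
  have "(LBINT s=ereal 0..\<infinity>. f s) = 0 - 0"
  proof (rule interval_integral_FTC_integrable)
    show "(F has_vector_derivative f s) (at s)" for s using d by (simp add: has_real_derivative_iff_has_vector_derivative)
    show "isCont f s" for s unfolding f_def by (intro continuous_intros DERIV_isCont[OF sq_normal_laplace_DERIV])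
    show "set_integrable lborel (einterval (ereal 0) \<infinity>) f"
      by (rule set_integrable_subset[of lborel "{0..}"]) (use intf in \<open>auto simp: set_integrable_def einterval_def\<close>)
    show "((F \<circ> real_of_ereal) \<longlongrightarrow> 0) (at_right (ereal 0))"
      using DERIV_isCont[OF d[of 0]] by (auto simp: ereal_tendsto_simps F_def isCont_def filterlim_at_split)
    show "((F \<circ> real_of_ereal) \<longlongrightarrow> 0) (at_left \<infinity>)"
      using lim by (simp add: ereal_tendsto_simps)
  qed simp
  moreover have "(LBINT s=ereal 0..\<infinity>. f s) = (\<integral>s. indicator {0..} s * f s \<partial>lborel)"
  proof -
    have "(LBINT s=ereal 0..\<infinity>. f s) = (LBINT s:{0<..}. f s)"
      by (simp add: interval_lebesgue_integral_def einterval_eq)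
    also have "\<dots> = (\<integral>s. indicator {0..} s * f s \<partial>lborel)"
      unfolding set_lebesgue_integral_def
      using AE_lborel_singleton[of "0::real"]
      by (intro integral_cong_AE) (auto simp: indicator_def f_def)
    finally show ?thesis .
  qed
  ultimately have "(\<integral>s. indicator {0..} s * f s \<partial>lborel) = 0" by simp
  then show ?thesis unfolding eqf using int by (simp add: chi_integral_def algebra_simps)
qed

lemma nn_integral_exp_square:
  assumes "0 < x"
  shows "(\<integral>\<^sup>+s. ennreal (indicator {0..} s * exp (- s\<^sup>2 * x)) \<partial>lborel) = ennreal (sqrt pi / (2 * sqrt x))"
proof -
  have 1: "(\<integral>\<^sup>+s. ennreal (indicator {0..} s *\<^sub>R exp (- s\<^sup>2)) \<partial>lborel) = ennreal (sqrt pi / 2)"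
    using gaussian_moment_0 by (subst nn_integral_eq_integral) (auto simp: has_bochner_integral_iff)
  have "(\<integral>\<^sup>+s. ennreal (indicator {0..} s *\<^sub>R exp (- s\<^sup>2)) \<partial>lborel) =
     ennreal \<bar>sqrt x\<bar> * (\<integral>\<^sup>+s. ennreal (indicator {0..} (0 + sqrt x * s) *\<^sub>R exp (- (0 + sqrt x * s)\<^sup>2)) \<partial>lborel)"
    using assms by (intro nn_integral_real_affine) auto
  also have "(\<integral>\<^sup>+s. ennreal (indicator {0..} (0 + sqrt x * s) *\<^sub>R exp (- (0 + sqrt x * s)\<^sup>2)) \<partial>lborel)
      = (\<integral>\<^sup>+s. ennreal (indicator {0..} s * exp (- s\<^sup>2 * x)) \<partial>lborel)"
    using assms by (intro nn_integral_cong) (auto simp: indicator_def power_mult_distrib zero_le_mult_iff mult.commute)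
  finally have 2: "ennreal (sqrt pi / 2) = ennreal (sqrt x) * (\<integral>\<^sup>+s. ennreal (indicator {0..} s * exp (- s\<^sup>2 * x)) \<partial>lborel)"
    using 1 assms by simp
  have "ennreal (sqrt pi / (2 * sqrt x)) = ennreal (1 / sqrt x) * ennreal (sqrt pi / 2)"
    using assms by (simp flip: ennreal_mult' )
  also have "\<dots> = ennreal (1 / sqrt x) * ennreal (sqrt x) * (\<integral>\<^sup>+s. ennreal (indicator {0..} s * exp (- s\<^sup>2 * x)) \<partial>lborel)"
    unfolding 2 by (simp add: mult.assoc)
  also have "ennreal (1 / sqrt x) * ennreal (sqrt x) = 1" using assms by (simp flip: ennreal_mult')
  finally show ?thesis by simp
qed

text \<open>This is Jensen's inequality for the Laplace transform of a squared standard normal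
  variable, whose mean is 1; here it follows from \<open>1 + x \<le> exp x\<close>.\<close>

lemma sq_normal_laplace_ge_exp: "exp (- s\<^sup>2) \<le> sq_normal_laplace s"
proof -
  have pos: "0 < 1 + 2 * s\<^sup>2" by (rule one_plus_square_pos)
  have "1 + 2 * s\<^sup>2 \<le> exp (2 * s\<^sup>2)" by (rule exp_ge_add_one_self)
  also have "\<dots> = (exp (s\<^sup>2))\<^sup>2" by (simp add: power2_eq_square flip: exp_add)
  finally have "sqrt (1 + 2 * s\<^sup>2) \<le> exp (s\<^sup>2)" by (intro real_le_lsqrt) auto
  then show ?thesis using pos unfolding sq_normal_laplace_def by (auto simp: exp_minus divide_simps)
qed

lemma chi_integral_ge:
  assumes "2 \<le> p" shows "sqrt pi / (2 * sqrt p) \<le> chi_integral p"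
proof -
  have "ennreal (sqrt pi / (2 * sqrt p)) = (\<integral>\<^sup>+s. ennreal (indicator {0..} s * exp (- s\<^sup>2 * p)) \<partial>lborel)"
    using assms by (intro nn_integral_exp_square[symmetric]) auto
  also have "\<dots> \<le> (\<integral>\<^sup>+s. ennreal (indicator {0..} s * sq_normal_laplace s ^ p) \<partial>lborel)"
  proof (rule nn_integral_mono)
    fix s :: real
    have "exp (- s\<^sup>2 * p) \<le> sq_normal_laplace s ^ p"
      using power_mono[OF sq_normal_laplace_ge_exp[of s], of p] by (simp add: exp_of_nat_mult[symmetric] mult.commute)
    then show "ennreal (indicator {0..} s * exp (- s\<^sup>2 * p)) \<le> ennreal (indicator {0..} s * sq_normal_laplace s ^ p)"
      by (intro ennreal_leI mult_left_mono) auto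
  qed
  also have "\<dots> = ennreal (chi_integral p)" unfolding chi_integral_def
    using sq_normal_laplace_pos by (intro nn_integral_eq_integral integrable_sq_normal_laplace_power assms) (auto intro!: AE_I2 mult_nonneg_nonneg simp: less_imp_le)
  moreover have "0 \<le> chi_integral p" unfolding chi_integral_def
    using sq_normal_laplace_pos by (intro integral_nonneg_AE) (auto intro!: AE_I2 mult_nonneg_nonneg simp: less_imp_le)
  ultimately show ?thesis by simp
qed

text \<open>If \<open>y\<close> is a sum of \<open>m\<close> squared standard normals,
  \<open>y * exp (- s^2 * y)\<close> has mean \<open>m * sq_normal_laplace s ^ (m + 2)\<close>: each
  summand contributes one cube and \<open>m - 1\<close> first powers. The factor
  \<open>2 / sqrt pi\<close> normalizes the integral representation of the square root.\<close>

definition chi_mean :: "nat \<Rightarrow> real"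
  where "chi_mean m = 2 * m / sqrt pi * chi_integral (m + 2)"

lemma chi_mean_rec: "real m * chi_mean (m + 2) = (real m + 1) * chi_mean m"
  using chi_integral_rec[of "m+2"] by (simp add: chi_mean_def field_simps) 

text \<open>For \<open>1 \<le> m\<close> this is weaker than the bound by
  \<open>sqrt (m - 1/2)\<close>, but it has the right leading order; it serves to bound the limit of
  the ratios along \<open>m + 2 * i\<close>.\<close>

lemma chi_mean_ge: "real m / sqrt (real m + 2) \<le> chi_mean m"
proof -
  have "2 * real m / sqrt pi * (sqrt pi / (2 * sqrt (real (m+2)))) \<le> chi_mean m"
    unfolding chi_mean_def by (intro mult_left_mono chi_integral_ge) auto
  then show ?thesis by (simp add: add.commute)
qed

lemma sqrt_ratio_tendsto_1: "(\<lambda>i. real (m + 2*i) / sqrt (real (m + 2*i) + 2) / sqrt (real (m+2*i) - 1/2)) \<longlonglongrightarrow> 1"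
proof -
  have "((\<lambda>x::real. sqrt (x\<^sup>2 / ((x+2) * (x-1/2)))) \<longlongrightarrow> sqrt 1) at_top"
    by (intro tendsto_real_sqrt) real_asymp
  moreover have "filterlim (\<lambda>i. real (m + 2*i)) at_top sequentially" by real_asymp
  ultimately have "((\<lambda>i. sqrt ((real (m + 2*i))\<^sup>2 / ((real (m + 2*i)+2) * (real (m + 2*i)-1/2)))) \<longlongrightarrow> sqrt 1) sequentially"
    by (rule filterlim_compose)
  then show ?thesis by (simp add: real_sqrt_divide real_sqrt_mult)
qed

text \<open>The ratio \<open>chi_mean m / sqrt (m - 1/2)\<close> decreases along \<open>m \<mapsto> m + 2\<close> and its limit is at least 1.\<close>
lemma chi_mean_lower:
  assumes "1 \<le> m"
  shows "sqrt (real m - 1/2) \<le> chi_mean m"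
proof -
  define r where "r i = chi_mean (m + 2 * i) / sqrt (real (m + 2*i) - 1/2)" for i
  have step: "r (Suc i) \<le> r i" for i
  proof -
    define l where "l = m + 2 * i"
    have l: "1 \<le> l" using assms by (simp add: l_def)
    have nn: "0 \<le> chi_mean l" using chi_mean_ge[of l] by (smt (verit) divide_nonneg_nonneg of_nat_0_le_iff real_sqrt_ge_zero)
    have c: "chi_mean (l+2) = (real l + 1) / l * chi_mean l"
      using chi_mean_rec[of l] l by (simp add: field_simps)
    \<comment> \<open>With a shift \<open>c\<close> in place of 1/2, the left side minus the right
      side is \<open>(1 - 2 * c) * l - c\<close>, so 1/2 is the smallest shift that works for all
      \<open>l\<close>.\<close>
    have "((real l + 1) * sqrt (real l - 1/2))\<^sup>2 \<le> (real l * sqrt (real l + 3/2))\<^sup>2"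
    proof -
      have "(real l + 1)\<^sup>2 * (real l - 1/2) \<le> (real l)\<^sup>2 * (real l + 3/2)"
        by (simp add: algebra_simps power2_eq_square)
      then show ?thesis using l by (simp add: power_mult_distrib)
    qed
    then have "(real l + 1) * sqrt (real l - 1/2) \<le> real l * sqrt (real l + 3/2)"
      by (rule power2_le_imp_le) simp
    then have "(real l + 1) / l / sqrt (real l + 3/2) \<le> 1 / sqrt (real l - 1/2)"
      using l by (simp add: divide_simps mult.commute)
    then have "(real l + 1) / l / sqrt (real l + 3/2) * chi_mean l \<le> 1 / sqrt (real l - 1/2) * chi_mean l"
      using nn by (rule mult_right_mono)
    moreover have "r (Suc i) = (real l + 1) / l / sqrt (real l + 3/2) * chi_mean l"
      unfolding r_def using c by (simp add: l_def algebra_simps)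
    ultimately show ?thesis by (simp add: r_def l_def)
  qed
  then have "decseq r" by (rule decseq_SucI)
  then have dec: "r i \<le> r 0" for i by (simp add: decseqD)
  have lower: "real (m + 2*i) / sqrt (real (m + 2*i) + 2) / sqrt (real (m+2*i) - 1/2) \<le> r i" for i
    unfolding r_def using assms by (intro divide_right_mono chi_mean_ge) auto
  have "(\<lambda>i. real (m + 2*i) / sqrt (real (m + 2*i) + 2) / sqrt (real (m+2*i) - 1/2)) \<longlonglongrightarrow> 1"
    by (rule sqrt_ratio_tendsto_1)
  then have "1 \<le> r 0"
    by (rule LIMSEQ_le_const2) (meson dec lower order_trans)
  then show ?thesis using assms by (simp add: r_def divide_simps)
qed

section \<open>Orthogonal invariance of the standard Gaussian measure\<close>

lemma nn_integral_lborel_shift: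
  fixes f :: "'v::euclidean_space \<Rightarrow> ennreal"
  assumes [measurable]: "f \<in> borel_measurable borel"
  shows "(\<integral>\<^sup>+x. f (c + x) \<partial>lborel) = (\<integral>\<^sup>+x. f x \<partial>lborel)"
  by (subst (2) lborel_distr_plus[of c, symmetric]) (simp add: nn_integral_distr)

lemma nn_integral_lborel_minus:
  fixes f :: "'v::euclidean_space \<Rightarrow> ennreal"
  assumes [measurable]: "f \<in> borel_measurable borel"
  shows "(\<integral>\<^sup>+x. f (c - x) \<partial>lborel) = (\<integral>\<^sup>+x. f x \<partial>lborel)"
  proof -
  have *: "lborel = distr lborel borel (\<lambda>x. c - x)" using lborel_affine[of "-1" c] by (simp add: density_1)
  show ?thesis by (subst (2) *) (simp add: nn_integral_distr)
qed

text \<open>Translation-invariant measures are proportional: for \<open>N\<close> invariant, Tonelli gives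
  \<open>N(A) L(B) = L(A) N(B)\<close>, and for the image \<open>N\<close> of Lebesgue measure \<open>L\<close> under an isometry
  the unit ball \<open>B\<close> shows that the factor is 1.\<close>
lemma lborel_distr_orthogonal:
  fixes T :: "'v::euclidean_space \<Rightarrow> 'v"
  assumes T: "orthogonal_transformation T"
  shows "distr lborel borel T = lborel"
proof (rule measure_eqI)
  let ?N = "distr lborel borel T"
  have lin: "linear T" and nrm: "\<And>x. norm (T x) = norm x" using T by (auto simp: orthogonal_transformation)
  have [measurable]: "T \<in> borel_measurable borel"
    using lin by (intro borel_measurable_continuous_onI linear_continuous_on linear_conv_bounded_linear[THEN iffD1])
  have surj: "surj T" by (rule orthogonal_transformation_surj[OF T])
  have shift: "(\<integral>\<^sup>+x. f (x + c) \<partial>?N) = (\<integral>\<^sup>+x. f x \<partial>?N)" if [measurable]: "f \<in> borel_measurable borel" for f c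
  proof -
    obtain d where d: "c = T d" using surj by (metis surjD)
    have "(\<integral>\<^sup>+x. f (x + c) \<partial>?N) = (\<integral>\<^sup>+x. f (T (d + x)) \<partial>lborel)"
      unfolding d by (simp add: nn_integral_distr linear_add[OF lin] add.commute)
    also have "\<dots> = (\<integral>\<^sup>+x. f (T x) \<partial>lborel)" by (rule nn_integral_lborel_shift) measurable
    finally show ?thesis by (simp add: nn_integral_distr)
  qed
  show "sets ?N = sets lborel" by simp
  define B where "B = ball (0::'v) 1"
  have [measurable]: "B \<in> sets borel" unfolding B_def by simp
  have ballN: "emeasure ?N (ball 0 r) = emeasure lborel (ball (0::'v) r)" for r
  proof -
    have "T -` ball 0 r = ball 0 r" using nrm by auto
    then show ?thesis by (subst emeasure_distr) auto
  qed
  interpret N: sigma_finite_measure ?N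
  proof (rule sigma_finite_measure.intro, intro exI conjI)
    show "countable (range (\<lambda>n::nat. ball (0::'v) n))" by auto
    show "range (\<lambda>n::nat. ball (0::'v) n) \<subseteq> sets ?N" by auto
    show "\<Union> (range (\<lambda>n::nat. ball (0::'v) n)) = space ?N"
      by (auto intro: reals_Archimedean2)
    show "\<forall>a\<in>range (\<lambda>n::nat. ball (0::'v) n). emeasure ?N a \<noteq> \<infinity>"
      using emeasure_lborel_ball_finite ballN by (auto simp: less_top)
  qed
  interpret P: pair_sigma_finite ?N lborel ..
  have Bpos: "emeasure lborel B \<noteq> 0" "emeasure lborel B \<noteq> \<infinity>"
    unfolding B_def using emeasure_lborel_ball_finite[of "0::'v" 1]
    by (auto simp: emeasure_ball less_top unit_ball_vol_pos ennreal_eq_0_iff not_le)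
  fix A assume "A \<in> sets ?N"
  then have [measurable]: "A \<in> sets borel" by simp
  have "emeasure ?N A * emeasure lborel B = (\<integral>\<^sup>+x. (\<integral>\<^sup>+y. indicator A x * indicator B y \<partial>lborel) \<partial>?N)"
    by (simp add: nn_integral_multc nn_integral_cmult)
  \<comment> \<open>Replacing \<open>y\<close> by \<open>x - y\<close> couples the variables. The
    shift by \<open>y\<close> then moves from \<open>B\<close> to \<open>A\<close> by invariance of
    \<open>?N\<close>, and disappears by invariance of Lebesgue measure.\<close>
  also have "\<dots> = (\<integral>\<^sup>+x. (\<integral>\<^sup>+y. indicator A x * indicator B (x - y) \<partial>lborel) \<partial>?N)"
    by (intro nn_integral_cong nn_integral_lborel_minus[symmetric]) measurable
  also have "\<dots> = (\<integral>\<^sup>+y. (\<integral>\<^sup>+x. indicator A x * indicator B (x - y) \<partial>?N) \<partial>lborel)"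
    by (rule P.Fubini'[symmetric]) measurable
  also have "\<dots> = (\<integral>\<^sup>+y. (\<integral>\<^sup>+x. indicator A (x + y) * indicator B x \<partial>?N) \<partial>lborel)"
  proof (rule nn_integral_cong)
    fix y
    show "(\<integral>\<^sup>+x. indicator A x * indicator B (x - y) \<partial>?N) = (\<integral>\<^sup>+x. indicator A (x + y) * indicator B x \<partial>?N)"
      using shift[of "\<lambda>x. indicator A x * indicator B (x - y)" y] by simp
  qed
  also have "\<dots> = (\<integral>\<^sup>+x. (\<integral>\<^sup>+y. indicator A (x + y) * indicator B x \<partial>lborel) \<partial>?N)"
    by (rule P.Fubini') measurable
  also have "\<dots> = (\<integral>\<^sup>+x. (\<integral>\<^sup>+y. indicator A y * indicator B x \<partial>lborel) \<partial>?N)"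
  proof (rule nn_integral_cong)
    fix x
    show "(\<integral>\<^sup>+y. indicator A (x + y) * indicator B x \<partial>lborel) = (\<integral>\<^sup>+y. indicator A y * indicator B x \<partial>lborel)"
      by (rule nn_integral_lborel_shift[of "\<lambda>y. indicator A y * indicator B x" x]) measurable
  qed
  also have "\<dots> = emeasure lborel A * emeasure lborel B"
    using ballN[of 1, folded B_def] by (simp add: nn_integral_multc nn_integral_cmult)
  finally show "emeasure ?N A = emeasure lborel A"
    using Bpos by (simp add: mult.commute[of _ "emeasure lborel B"] ennreal_mult_cancel_left)
qed

text \<open>The product form lets integrals factor over \<open>Basis\<close> and matches independent
  coordinates; rotation invariance is read off the equivalent density.\<close>

definition gauss :: "'v::euclidean_space measure"
  where "gauss = distr (\<Pi>\<^sub>M b\<in>Basis. density lborel std_normal_density) borel (\<lambda>f. \<Sum>b\<in>Basis. f b *\<^sub>R b)"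

lemma PiM_density:
  fixes N :: "'i \<Rightarrow> 'b measure"
  assumes "finite I" "\<And>i. sigma_finite_measure (N i)" "\<And>i. sigma_finite_measure (density (N i) (g i))"
    and [measurable]: "\<And>i. g i \<in> borel_measurable (N i)"
  shows "PiM I (\<lambda>i. density (N i) (g i)) = density (PiM I N) (\<lambda>x. \<Prod>i\<in>I. g i (x i))"
proof -
  interpret N: product_sigma_finite N using assms by (simp add: product_sigma_finite_def)
  interpret D: product_sigma_finite "\<lambda>i. density (N i) (g i)" using assms by (simp add: product_sigma_finite_def)
  show ?thesis
  proof (rule D.PiM_eqI[symmetric])
    show "finite I" by fact
    show "sets (density (PiM I N) (\<lambda>x. \<Prod>i\<in>I. g i (x i))) = sets (PiM I (\<lambda>i. density (N i) (g i)))"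
      by (simp cong: sets_PiM_cong)
    fix A assume A: "\<And>i. i \<in> I \<Longrightarrow> A i \<in> sets (density (N i) (g i))"
    have [measurable]: "Pi\<^sub>E I A \<in> sets (PiM I N)" using A \<open>finite I\<close> by (intro sets_PiM_I_finite) auto
    have "emeasure (density (PiM I N) (\<lambda>x. \<Prod>i\<in>I. g i (x i))) (Pi\<^sub>E I A) =
      (\<integral>\<^sup>+x. (\<Prod>i\<in>I. g i (x i)) * indicator (Pi\<^sub>E I A) x \<partial>PiM I N)"
      by (rule emeasure_density) measurable
    also have "\<dots> = (\<integral>\<^sup>+x. (\<Prod>i\<in>I. g i (x i) * indicator (A i) (x i)) \<partial>PiM I N)"
    proof (rule nn_integral_cong)
      fix x assume x: "x \<in> space (PiM I N)"
      show "(\<Prod>i\<in>I. g i (x i)) * indicator (Pi\<^sub>E I A) x = (\<Prod>i\<in>I. g i (x i) * indicator (A i) (x i))"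
      proof (cases "x \<in> Pi\<^sub>E I A")
        case True
        then have "indicator (A i) (x i) = (1::ennreal)" if "i \<in> I" for i
          using that True by (auto simp: indicator_def)
        then show ?thesis using True by simp
      next
        case False
        then obtain i where "i \<in> I" "x i \<notin> A i" using x by (auto simp: space_PiM PiE_iff)
        then have "(\<Prod>i\<in>I. g i (x i) * indicator (A i) (x i)) = 0"
          using \<open>finite I\<close> by (intro prod_zero bexI[of _ i]) (simp_all add: indicator_def)
        then show ?thesis using False by simp
      qed
    qed
    also have "\<dots> = (\<Prod>i\<in>I. (\<integral>\<^sup>+x. g i x * indicator (A i) x \<partial>N i))"
      using A \<open>finite I\<close> by (intro N.product_nn_integral_prod) auto
    also have "\<dots> = (\<Prod>i\<in>I. emeasure (density (N i) (g i)) (A i))"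
      using A by (intro prod.cong refl emeasure_density[symmetric]) auto
    finally show "emeasure (density (PiM I N) (\<lambda>x. \<Prod>i\<in>I. g i (x i))) (Pi\<^sub>E I A) = (\<Prod>i\<in>I. emeasure (density (N i) (g i)) (A i))" .
  qed
qed

lemma prob_space_std_normal: "prob_space (density lborel std_normal_density)"
  by (rule prob_space_normal_density) simp

lemma prod_std_normal_density:
  fixes v :: "'v::euclidean_space"
  shows "(\<Prod>b\<in>Basis. ennreal (std_normal_density (v \<bullet> b)))
    = ennreal ((1 / sqrt (2 * pi)) ^ DIM('v) * exp (- (norm v)\<^sup>2 / 2))"
proof -
  have "(\<Prod>b\<in>Basis. std_normal_density (v \<bullet> b)) =
      (1 / sqrt (2 * pi)) ^ DIM('v) * exp (\<Sum>b\<in>Basis. - (v \<bullet> b)\<^sup>2 / 2)"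
    unfolding std_normal_density_def prod.distrib by (simp add: exp_sum)
  also have "(\<Sum>b\<in>Basis. - (v \<bullet> b)\<^sup>2 / 2) = - (norm v)\<^sup>2 / 2"
    unfolding power2_norm_eq_inner
    by (subst euclidean_inner[of v v]) (simp add: power2_eq_square sum_negf sum_divide_distrib)
  finally show ?thesis by (subst prod_ennreal) (auto)
qed

text \<open>The product of the coordinate densities depends on the norm only, which is what an
  orthogonal map preserves.\<close>

lemma gauss_eq_density:
  "(gauss :: 'v::euclidean_space measure)
    = density lborel (\<lambda>v. ennreal ((1 / sqrt (2 * pi)) ^ DIM('v) * exp (- (norm v)\<^sup>2 / 2)))"
proof -
  interpret prob_space "density lborel std_normal_density" by (rule prob_space_std_normal)
  let ?F = "\<lambda>f. \<Sum>b\<in>(Basis::'v set). f b *\<^sub>R b"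
  let ?g = "\<lambda>v::'v. \<Prod>b\<in>Basis. ennreal (std_normal_density (v \<bullet> b))"
  have "(gauss :: 'v measure) = distr (density (\<Pi>\<^sub>M b\<in>Basis. lborel) (\<lambda>x. \<Prod>b\<in>Basis. ennreal (std_normal_density (x b)))) borel ?F"
    unfolding gauss_def by (subst PiM_density) (auto intro: sigma_finite_lborel sigma_finite_measure)
  also have "\<dots> = distr (density (\<Pi>\<^sub>M b\<in>Basis. lborel) (\<lambda>x. ?g (?F x))) borel ?F"
    by (simp add: inner_sum_left inner_Basis if_distrib cong: if_cong prod.cong)
  also have "\<dots> = density (distr (\<Pi>\<^sub>M b\<in>Basis. lborel) borel ?F) ?g"
    by (rule density_distr[symmetric]) measurable
  also have "\<dots> = density lborel ?g" by (subst lborel_eq) simp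
  finally show ?thesis by (simp add: prod_std_normal_density)
qed

lemma sets_gauss [measurable_cong, simp]: "sets gauss = sets borel"
  by (simp add: gauss_def)

lemma space_gauss [simp]: "space gauss = UNIV"
  by (simp add: gauss_def)

lemma prob_space_gauss: "prob_space gauss"
  unfolding gauss_def
  by (intro prob_space.prob_space_distr prob_space_PiM prob_space_std_normal) measurable

lemma distr_gauss_orthogonal:
  fixes T :: "'v::euclidean_space \<Rightarrow> 'v"
  assumes T: "orthogonal_transformation T"
  shows "distr gauss borel T = gauss"
proof -
  have lin: "linear T" and nrm: "\<And>x. norm (T x) = norm x" using T by (auto simp: orthogonal_transformation)
  have [measurable]: "T \<in> borel_measurable borel"
    using lin by (intro borel_measurable_continuous_onI linear_continuous_on linear_conv_bounded_linear[THEN iffD1])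
  let ?g = "\<lambda>v::'v. ennreal ((1 / sqrt (2 * pi)) ^ DIM('v) * exp (- (norm v)\<^sup>2 / 2))"
  have "distr gauss borel T = distr (density lborel (\<lambda>v. ?g (T v))) borel T"
    unfolding gauss_eq_density by (simp add: nrm)
  also have "\<dots> = density (distr lborel borel T) ?g"
    by (rule density_distr[symmetric]) measurable
  finally show ?thesis using T by (simp add: lborel_distr_orthogonal gauss_eq_density)
qed

lemma (in prob_space) distr_iid_normal:
  fixes X :: "'a \<Rightarrow> 'v::euclidean_space"
  assumes "indep_vars (\<lambda>_. borel) (\<lambda>b \<omega>. X \<omega> \<bullet> b) Basis"
    and "\<And>b. b \<in> Basis \<Longrightarrow> distr M borel (\<lambda>\<omega>. X \<omega> \<bullet> b) = density lborel std_normal_density"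
  shows "distr M borel X = gauss"
proof -
  have rv: "(\<lambda>\<omega>. X \<omega> \<bullet> b) \<in> borel_measurable M" if "b \<in> Basis" for b
    using assms(1) that by (auto simp: indep_vars_def)
  then have "X \<in> borel_measurable M" by (rule borel_measurable_euclidean_space[THEN iffD2, rule_format])
  then have [measurable]: "(\<lambda>\<omega>. X \<omega> \<bullet> b) \<in> borel_measurable M" for b by measurable
  have "distr M (\<Pi>\<^sub>M b\<in>Basis. borel) (\<lambda>\<omega>. \<lambda>b\<in>Basis. X \<omega> \<bullet> b) = (\<Pi>\<^sub>M b\<in>Basis. distr M borel (\<lambda>\<omega>. X \<omega> \<bullet> b))"
    using assms(1) by (subst (asm) indep_vars_iff_distr_eq_PiM) auto
  also have "\<dots> = (\<Pi>\<^sub>M b\<in>Basis. density lborel std_normal_density)"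
    using assms(2) by (intro PiM_cong) auto
  finally have *: "(gauss :: 'v measure) = distr (distr M (\<Pi>\<^sub>M b\<in>Basis. borel) (\<lambda>\<omega>. \<lambda>b\<in>Basis. X \<omega> \<bullet> b)) borel (\<lambda>f. \<Sum>b\<in>Basis. f b *\<^sub>R b)"
    unfolding gauss_def by simp
  show ?thesis unfolding * by (subst distr_distr) (auto simp: comp_def euclidean_representation)
qed

section \<open>Gaussian integrals behind the chi mean\<close>

lemma nn_integral_std_normal:
  assumes [measurable]: "f \<in> borel_measurable borel" and "\<And>x. 0 \<le> f x"
  shows "(\<integral>\<^sup>+x. ennreal (f x * exp (- s\<^sup>2 * x\<^sup>2)) \<partial>density lborel std_normal_density)
    = ennreal (sq_normal_laplace s) * (\<integral>\<^sup>+x. ennreal (normal_density 0 (sq_normal_laplace s) x * f x) \<partial>lborel)"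
proof -
  \<comment> \<open>Exponential tilting gives another centered normal density:
    \<open>sq_normal_laplace s\<close> is both its standard deviation and the mass that is split
    off.\<close>
  have eq: "std_normal_density x * exp (- s\<^sup>2 * x\<^sup>2) = sq_normal_laplace s * normal_density 0 (sq_normal_laplace s) x" for x
  proof -
    have "x\<^sup>2 / (2 * (sq_normal_laplace s)\<^sup>2) = x\<^sup>2 / 2 + s\<^sup>2 * x\<^sup>2"
      unfolding sq_normal_laplace_square using one_plus_square_pos[of s] by (simp add: field_simps)
    moreover have "sq_normal_laplace s / sqrt (2 * pi * (sq_normal_laplace s)\<^sup>2) = 1 / sqrt (2 * pi)"
      using sq_normal_laplace_pos[of s] by (simp add: real_sqrt_mult)
    moreover have "sq_normal_laplace s * normal_density 0 (sq_normal_laplace s) x = sq_normal_laplace s / sqrt (2 * pi * (sq_normal_laplace s)\<^sup>2) * exp (- (x\<^sup>2 / (2 * (sq_normal_laplace s)\<^sup>2)))"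
      by (simp add: normal_density_def)
    ultimately have "sq_normal_laplace s * normal_density 0 (sq_normal_laplace s) x = 1 / sqrt (2 * pi) * exp (- (x\<^sup>2 / 2 + s\<^sup>2 * x\<^sup>2))"
      by simp
    then show ?thesis by (simp add: std_normal_density_def flip: exp_add)
  qed
  have "(\<integral>\<^sup>+x. ennreal (f x * exp (- s\<^sup>2 * x\<^sup>2)) \<partial>density lborel std_normal_density)
     = (\<integral>\<^sup>+x. ennreal (std_normal_density x) * ennreal (f x * exp (- s\<^sup>2 * x\<^sup>2)) \<partial>lborel)"
    by (rule nn_integral_density) auto
  also have "\<dots> = (\<integral>\<^sup>+x. ennreal (sq_normal_laplace s) * ennreal (normal_density 0 (sq_normal_laplace s) x * f x) \<partial>lborel)"
  proof (rule nn_integral_cong)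
    fix x
    have "std_normal_density x * (f x * exp (- s\<^sup>2 * x\<^sup>2)) = sq_normal_laplace s * (normal_density 0 (sq_normal_laplace s) x * f x)"
      using eq[of x] by (simp add: ac_simps)
    then show "ennreal (std_normal_density x) * ennreal (f x * exp (- s\<^sup>2 * x\<^sup>2)) = ennreal (sq_normal_laplace s) * ennreal (normal_density 0 (sq_normal_laplace s) x * f x)"
      using sq_normal_laplace_pos[of s] assms(2)[of x] by (simp only: ennreal_mult'[symmetric] normal_density_nonneg less_imp_le)
  qed
  also have "\<dots> = ennreal (sq_normal_laplace s) * (\<integral>\<^sup>+x. ennreal (normal_density 0 (sq_normal_laplace s) x * f x) \<partial>lborel)"
    by (rule nn_integral_cmult) measurable
  finally show ?thesis .
qed

lemma nn_integral_std_normal_exp: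
  "(\<integral>\<^sup>+x. ennreal (exp (- s\<^sup>2 * x\<^sup>2)) \<partial>density lborel std_normal_density) = ennreal (sq_normal_laplace s)"
  using nn_integral_std_normal[of "\<lambda>_. 1" s] sq_normal_laplace_pos[of s]
  by (simp add: nn_integral_eq_integral)

lemma nn_integral_std_normal_square_exp:
  "(\<integral>\<^sup>+x. ennreal (x\<^sup>2 * exp (- s\<^sup>2 * x\<^sup>2)) \<partial>density lborel std_normal_density) = ennreal (sq_normal_laplace s ^ 3)"
proof -
  have "(\<integral>\<^sup>+x. ennreal (normal_density 0 (sq_normal_laplace s) x * x\<^sup>2) \<partial>lborel) = ennreal ((sq_normal_laplace s)\<^sup>2)"
    using normal_moment_even[OF sq_normal_laplace_pos[of s], of 0 1] sq_normal_laplace_pos[of s]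
    by (subst nn_integral_eq_integral) (auto simp: has_bochner_integral_iff power2_eq_square)
  then show ?thesis
    using nn_integral_std_normal[of "\<lambda>x. x\<^sup>2" s] sq_normal_laplace_pos[of s]
    by (simp add: power3_eq_cube power2_eq_square mult.assoc flip: ennreal_mult')
qed

text \<open>The half-line integral of \<open>exp (- s^2 * y)\<close> is
  \<open>sqrt pi / (2 * sqrt y)\<close>. Multiplying by \<open>y\<close> inverts the square root and
  makes the formula valid at 0.\<close>

lemma sqrt_eq_nn_integral:
  assumes "0 \<le> y"
  shows "ennreal (sqrt y) = (\<integral>\<^sup>+s. ennreal (2 / sqrt pi * indicator {0..} s) * ennreal (y * exp (- s\<^sup>2 * y)) \<partial>lborel)"
proof (cases "y = 0")
  case False
  then have y: "0 < y" using assms by simp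
  have "(\<integral>\<^sup>+s. ennreal (2 / sqrt pi * indicator {0..} s) * ennreal (y * exp (- s\<^sup>2 * y)) \<partial>lborel)
    = (\<integral>\<^sup>+s. ennreal (2 / sqrt pi * y) * ennreal (indicator {0..} s * exp (- s\<^sup>2 * y)) \<partial>lborel)"
    using y by (intro nn_integral_cong) (simp add: ac_simps flip: ennreal_mult')
  also have "\<dots> = ennreal (2 / sqrt pi * y) * ennreal (sqrt pi / (2 * sqrt y))"
    unfolding nn_integral_exp_square[OF y, symmetric] by (rule nn_integral_cmult) measurable
  also have "\<dots> = ennreal (sqrt y)"
    using y by (simp add: real_div_sqrt flip: ennreal_mult')
  finally show ?thesis by simp
qed simp

text \<open>Inserting \<open>sqrt y = 2 / sqrt pi * (\<integral>s\<ge>0. y * exp (- s\<^sup>2 * y))\<close> factorises the expectation over coordinates.\<close>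
lemma gauss_chi_mean:
  fixes B :: "'v::euclidean_space set"
  assumes B: "B \<subseteq> Basis"
  shows "(\<integral>\<^sup>+g. ennreal (sqrt (\<Sum>b\<in>B. (g \<bullet> b)\<^sup>2)) \<partial>gauss) = ennreal (chi_mean (card B))"
proof -
  let ?N = "density lborel (\<lambda>x. ennreal (std_normal_density x))"
  let ?P = "\<Pi>\<^sub>M b\<in>(Basis::'v set). ?N"
  interpret N: prob_space ?N by (rule prob_space_std_normal)
  interpret PP: product_prob_space "\<lambda>_::'v. ?N" ..
  interpret fP: finite_product_prob_space "\<lambda>_::'v. ?N" Basis by standard auto
  interpret pair_sigma_finite ?P "lborel :: real measure" by standard
  have fB: "finite B" using B finite_Basis finite_subset by blast
  define m where "m = card B"
  have sq [measurable]: "(\<lambda>f. \<Sum>b\<in>B. (f b)\<^sup>2) \<in> borel_measurable ?P"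
    using B by (intro borel_measurable_sum borel_measurable_power) (auto simp: measurable_component_singleton subset_iff)
  have [measurable]: "(\<lambda>x. \<Sum>b\<in>B. (fst x b)\<^sup>2) \<in> borel_measurable (?P \<Otimes>\<^sub>M (lborel :: real measure))"
    by (rule measurable_compose[OF measurable_fst sq])
  define c where "c s = 2 / sqrt pi * indicator {0..} s" for s :: real
  have [measurable]: "c \<in> borel_measurable borel" unfolding c_def by measurable
  \<comment> \<open>For fixed \<open>d\<close> these are the coordinate factors of
    \<open>(f d)^2 * exp (- s^2 * y)\<close>, where \<open>y\<close> sums the squares over
    \<open>B\<close>; the value 1 outside \<open>B\<close> lets the product run over all of
    \<open>Basis\<close>.\<close>
  define u where "u s d b x = (if b \<in> B then (if b = d then x\<^sup>2 else 1) * exp (- s\<^sup>2 * x\<^sup>2) else 1)" for s :: real and d b :: 'v and x :: real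
  have u_int: "(\<integral>\<^sup>+x. ennreal (u s d b x) \<partial>?N) = ennreal (if b \<in> B then if b = d then sq_normal_laplace s ^ 3 else sq_normal_laplace s else 1)" for s d b
    using nn_integral_std_normal_square_exp[of s] nn_integral_std_normal_exp[of s] N.emeasure_space_1
    by (auto simp: u_def)
  have u0: "0 \<le> u s d b x" for s d b x by (auto simp: u_def)
  have inner: "(\<integral>\<^sup>+f. ennreal ((\<Sum>b\<in>B. (f b)\<^sup>2) * exp (- s\<^sup>2 * (\<Sum>b\<in>B. (f b)\<^sup>2))) \<partial>?P) = ennreal (m * sq_normal_laplace s ^ (m+2))" for s
  proof -
    have split: "(\<Sum>b\<in>B. (f b)\<^sup>2) * exp (- s\<^sup>2 * (\<Sum>b\<in>B. (f b)\<^sup>2)) = (\<Sum>d\<in>B. \<Prod>b\<in>Basis. u s d b (f b))" for f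
    proof -
      have "(\<Prod>b\<in>Basis. u s d b (f b)) = (f d)\<^sup>2 * exp (- s\<^sup>2 * (\<Sum>b\<in>B. (f b)\<^sup>2))" if "d \<in> B" for d
      proof -
        have "(\<Prod>b\<in>Basis. u s d b (f b)) = (\<Prod>b\<in>B. u s d b (f b))"
          using B by (intro prod.mono_neutral_right) (auto simp: u_def)
        also have "\<dots> = (\<Prod>b\<in>B. (if b = d then (f b)\<^sup>2 else 1)) * (\<Prod>b\<in>B. exp (- s\<^sup>2 * (f b)\<^sup>2))"
          by (simp add: u_def prod.distrib)
        also have "(\<Prod>b\<in>B. exp (- s\<^sup>2 * (f b)\<^sup>2)) = exp (- s\<^sup>2 * (\<Sum>b\<in>B. (f b)\<^sup>2))"
          using fB by (simp add: exp_sum[symmetric] sum_distrib_left)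
        finally show ?thesis using that fB by simp
      qed
      then show ?thesis by (simp add: sum_distrib_right)
    qed
    have "(\<integral>\<^sup>+f. ennreal ((\<Sum>b\<in>B. (f b)\<^sup>2) * exp (- s\<^sup>2 * (\<Sum>b\<in>B. (f b)\<^sup>2))) \<partial>?P)
      = (\<integral>\<^sup>+f. (\<Sum>d\<in>B. \<Prod>b\<in>Basis. ennreal (u s d b (f b))) \<partial>?P)"
      unfolding split by (intro nn_integral_cong) (simp add: u0 sum_nonneg prod_nonneg flip: prod_ennreal sum_ennreal)
    also have "\<dots> = (\<Sum>d\<in>B. \<integral>\<^sup>+f. (\<Prod>b\<in>Basis. ennreal (u s d b (f b))) \<partial>?P)"
      unfolding u_def by (intro nn_integral_sum) measurable
    also have "\<dots> = (\<Sum>d\<in>B. \<Prod>b\<in>Basis. (\<integral>\<^sup>+x. ennreal (u s d b x) \<partial>?N))"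
    proof (intro sum.cong refl)
      fix d
      show "(\<integral>\<^sup>+f. (\<Prod>b\<in>Basis. ennreal (u s d b (f b))) \<partial>?P) = (\<Prod>b\<in>Basis. (\<integral>\<^sup>+x. ennreal (u s d b x) \<partial>?N))"
        unfolding u_def by (intro PP.product_nn_integral_prod[where f="\<lambda>b x. ennreal (u s d b x)" for d, unfolded u_def]) auto
    qed
    also have "\<dots> = (\<Sum>d\<in>B. ennreal (sq_normal_laplace s ^ (m + 2)))"
    proof (intro sum.cong refl)
      fix d assume d: "d \<in> B"
      have "(\<Prod>b\<in>Basis. if b \<in> B then if b = d then sq_normal_laplace s ^ 3 else sq_normal_laplace s else 1) = (\<Prod>b\<in>B. if b = d then sq_normal_laplace s ^ 3 else sq_normal_laplace s)"
        using B by (intro prod.mono_neutral_cong_right) auto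
      also have "\<dots> = sq_normal_laplace s ^ 3 * (\<Prod>b\<in>B - {d}. sq_normal_laplace s)"
        using fB d by (subst prod.remove[of _ d]) (auto intro!: prod.cong)
      also have "\<dots> = sq_normal_laplace s ^ (m + 2)"
      proof -
        have "m = Suc (card (B - {d}))" unfolding m_def by (rule card.remove[OF fB d])
        then show ?thesis by (simp add: power3_eq_cube)
      qed
      finally show "(\<Prod>b\<in>Basis. (\<integral>\<^sup>+x. ennreal (u s d b x) \<partial>?N)) = ennreal (sq_normal_laplace s ^ (m + 2))"
        unfolding u_int using sq_normal_laplace_pos[of s] by (subst prod_ennreal) (auto simp: less_imp_le)
    qed
    also have "\<dots> = ennreal (m * sq_normal_laplace s ^ (m+2))"
      using sq_normal_laplace_pos[of s] by (simp add: m_def ennreal_mult' ennreal_of_nat_eq_real_of_nat)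
    finally show ?thesis .
  qed
  have "(\<integral>\<^sup>+g. ennreal (sqrt (\<Sum>b\<in>B. (g \<bullet> b)\<^sup>2)) \<partial>gauss) = (\<integral>\<^sup>+f. ennreal (sqrt (\<Sum>b\<in>B. (f b)\<^sup>2)) \<partial>?P)"
    unfolding gauss_def using B
    by (subst nn_integral_distr) (auto simp: inner_sum_left inner_Basis if_distrib subset_iff cong: if_cong sum.cong)
  also have "\<dots> = (\<integral>\<^sup>+f. (\<integral>\<^sup>+s. ennreal (c s) * ennreal ((\<Sum>b\<in>B. (f b)\<^sup>2) * exp (- s\<^sup>2 * (\<Sum>b\<in>B. (f b)\<^sup>2))) \<partial>lborel) \<partial>?P)"
    unfolding c_def by (intro nn_integral_cong sqrt_eq_nn_integral sum_nonneg) auto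
  also have "\<dots> = (\<integral>\<^sup>+s. (\<integral>\<^sup>+f. ennreal (c s) * ennreal ((\<Sum>b\<in>B. (f b)\<^sup>2) * exp (- s\<^sup>2 * (\<Sum>b\<in>B. (f b)\<^sup>2))) \<partial>?P) \<partial>lborel)"
    by (intro Fubini'[symmetric]) measurable
  also have "\<dots> = (\<integral>\<^sup>+s. ennreal (c s) * ennreal (m * sq_normal_laplace s ^ (m+2)) \<partial>lborel)"
  proof (rule nn_integral_cong)
    fix s
    have "(\<integral>\<^sup>+f. ennreal (c s) * ennreal ((\<Sum>b\<in>B. (f b)\<^sup>2) * exp (- s\<^sup>2 * (\<Sum>b\<in>B. (f b)\<^sup>2))) \<partial>?P)
      = ennreal (c s) * (\<integral>\<^sup>+f. ennreal ((\<Sum>b\<in>B. (f b)\<^sup>2) * exp (- s\<^sup>2 * (\<Sum>b\<in>B. (f b)\<^sup>2))) \<partial>?P)"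
      by (intro nn_integral_cmult) measurable
    then show "(\<integral>\<^sup>+f. ennreal (c s) * ennreal ((\<Sum>b\<in>B. (f b)\<^sup>2) * exp (- s\<^sup>2 * (\<Sum>b\<in>B. (f b)\<^sup>2))) \<partial>?P) = ennreal (c s) * ennreal (m * sq_normal_laplace s ^ (m+2))"
      by (simp only: inner)
  qed
  also have "\<dots> = (\<integral>\<^sup>+s. ennreal (2 * m / sqrt pi * (indicator {0..} s * sq_normal_laplace s ^ (m+2))) \<partial>lborel)"
    using sq_normal_laplace_pos by (intro nn_integral_cong) (simp add: c_def ac_simps less_imp_le flip: ennreal_mult')
  also have "\<dots> = ennreal (\<integral>s. 2 * m / sqrt pi * (indicator {0..} s * sq_normal_laplace s ^ (m+2)) \<partial>lborel)"
    using sq_normal_laplace_pos by (intro nn_integral_eq_integral integrable_mult_right integrable_sq_normal_laplace_power)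
      (auto intro!: AE_I2 mult_nonneg_nonneg simp: less_imp_le)
  also have "\<dots> = ennreal (chi_mean m)" by (simp add: chi_mean_def chi_integral_def)
  finally show ?thesis by (simp add: m_def)
qed

section \<open>Gram-Schmidt orthonormalization\<close>

declare sum.cong [fundef_cong]

text \<open>Since \<open>sgn 0 = 0\<close>, a vector dependent on its predecessors yields the frame
  vector 0. Expansion and equivariance therefore hold for every input; only orthonormality requires
  nonzero residuals.\<close>

fun gram_schmidt :: "(nat \<Rightarrow> 'v::real_inner) \<Rightarrow> nat \<Rightarrow> 'v"
  where "gram_schmidt x j = sgn (x j - (\<Sum>i<j. (x j \<bullet> gram_schmidt x i) *\<^sub>R gram_schmidt x i))"

declare gram_schmidt.simps [simp del]

definition gs_residual :: "(nat \<Rightarrow> 'v::real_inner) \<Rightarrow> nat \<Rightarrow> 'v"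
  where "gs_residual x j = x j - (\<Sum>i<j. (x j \<bullet> gram_schmidt x i) *\<^sub>R gram_schmidt x i)"

lemma gram_schmidt_residual: "gram_schmidt x j = sgn (gs_residual x j)"
  by (subst gram_schmidt.simps) (simp add: gs_residual_def)

lemma gram_schmidt_cong: "(\<And>i. i \<le> j \<Longrightarrow> x i = y i) \<Longrightarrow> gram_schmidt x j = gram_schmidt y j"
proof (induction j rule: less_induct)
  case (less j)
  then have "gram_schmidt x i = gram_schmidt y i" if "i < j" for i using that by simp
  then show ?case using less.prems by (subst (1 2) gram_schmidt.simps) simp
qed

lemma norm_gram_schmidt: "norm (gram_schmidt x j) = (if gs_residual x j = 0 then 0 else 1)"
  by (simp add: gram_schmidt_residual norm_sgn)

lemma gram_schmidt_inner_self:
  "gram_schmidt x j \<bullet> gram_schmidt x j = (if gs_residual x j = 0 then 0 else 1)"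
  by (simp add: norm_gram_schmidt flip: power2_norm_eq_inner)

lemma residual_eq: "gs_residual x j = norm (gs_residual x j) *\<^sub>R gram_schmidt x j"
  by (cases "gs_residual x j = 0") (simp_all add: gram_schmidt_residual sgn_div_norm)

lemma gram_schmidt_orthogonal_less: "i < j \<Longrightarrow> gram_schmidt x j \<bullet> gram_schmidt x i = 0"
proof (induction j arbitrary: i rule: less_induct)
  case (less j)
  have orth: "gram_schmidt x l \<bullet> gram_schmidt x i = 0" if "l < j" "l \<noteq> i" for l
    using less.IH[of l i] less.IH[of i l] less.prems that by (metis inner_commute linorder_neqE_nat)
  have "(\<Sum>l<j. (x j \<bullet> gram_schmidt x l) * (gram_schmidt x l \<bullet> gram_schmidt x i))
      = (\<Sum>l<j. if l = i then x j \<bullet> gram_schmidt x i * (gram_schmidt x i \<bullet> gram_schmidt x i) else 0)"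
    by (intro sum.cong) (auto simp: orth)
  \<comment> \<open>If the residual at \<open>i\<close> vanishes, then
    \<open>gram_schmidt x i\<close> is 0 and both sides are 0.\<close>
  also have "\<dots> = x j \<bullet> gram_schmidt x i"
    using less.prems by (simp add: gram_schmidt_inner_self) (simp add: gram_schmidt_residual)
  finally have "gs_residual x j \<bullet> gram_schmidt x i = 0"
    by (simp add: gs_residual_def inner_diff_left inner_sum_left)
  then show ?case by (subst gram_schmidt_residual) (simp add: sgn_div_norm)
qed

lemma gram_schmidt_orthogonal: "i \<noteq> j \<Longrightarrow> gram_schmidt x i \<bullet> gram_schmidt x j = 0"
  by (metis gram_schmidt_orthogonal_less inner_commute linorder_neqE_nat)

lemma vector_eq_residual: "x j = gs_residual x j + (\<Sum>i<j. (x j \<bullet> gram_schmidt x i) *\<^sub>R gram_schmidt x i)"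
  by (simp add: gs_residual_def)

lemma inner_gram_schmidt_greater: assumes "j < i" shows "x j \<bullet> gram_schmidt x i = 0"
  using assms by (subst vector_eq_residual[of x j], subst residual_eq)
    (simp add: inner_add_left inner_sum_left gram_schmidt_orthogonal)

text \<open>The subtracted projection is orthogonal to the new frame vector. So the diagonal of the
  triangular factor holds distances to the span of the preceding vectors, whose means can be bounded
  one column at a time.\<close>

lemma inner_gram_schmidt_same: "x j \<bullet> gram_schmidt x j = norm (gs_residual x j)"
proof -
  have "x j \<bullet> gram_schmidt x j = gs_residual x j \<bullet> gram_schmidt x j"
    by (subst vector_eq_residual[of x j]) (simp add: inner_add_left inner_sum_left gram_schmidt_orthogonal)
  also have "\<dots> = norm (gs_residual x j)"
    by (subst residual_eq) (simp add: gram_schmidt_inner_self)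
  finally show ?thesis .
qed

lemma gram_schmidt_expansion:
  assumes "j < K"
  shows "x j = (\<Sum>i<K. (x j \<bullet> gram_schmidt x i) *\<^sub>R gram_schmidt x i)"
proof -
  have "(\<Sum>i<K. (x j \<bullet> gram_schmidt x i) *\<^sub>R gram_schmidt x i) = (\<Sum>i<Suc j. (x j \<bullet> gram_schmidt x i) *\<^sub>R gram_schmidt x i)"
    using assms by (intro sum.mono_neutral_right) (auto simp: inner_gram_schmidt_greater)
  also have "\<dots> = (\<Sum>i<j. (x j \<bullet> gram_schmidt x i) *\<^sub>R gram_schmidt x i) + gs_residual x j"
    by (simp add: inner_gram_schmidt_same residual_eq[symmetric])
  finally show ?thesis using vector_eq_residual[of x j] by (metis add.commute)
qed

text \<open>The coefficients of the recursion are inner products, unchanged by \<open>T\<close>, and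
  \<open>T\<close> commutes with \<open>sgn\<close>. Thus the frame of a Gaussian family inherits
  the rotation invariance of the family.\<close>

lemma gram_schmidt_equivariant:
  fixes x :: "nat \<Rightarrow> 'v::euclidean_space"
  assumes "orthogonal_transformation T"
  shows "gram_schmidt (\<lambda>i. T (x i)) j = T (gram_schmidt x j)"
proof (induction j rule: less_induct)
  case (less j)
  have lin: "linear T" and nrm: "\<And>x. norm (T x) = norm x" and inn: "\<And>x y. T x \<bullet> T y = x \<bullet> y"
    using assms by (auto simp: orthogonal_transformation_def orthogonal_transformation_norm)
  have "gram_schmidt (\<lambda>i. T (x i)) j = sgn (T (gs_residual x j))"
    using less by (subst gram_schmidt.simps)
      (simp add: inn gs_residual_def linear_diff[OF lin] linear_sum[OF lin] linear_scale[OF lin])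
  also have "\<dots> = T (sgn (gs_residual x j))"
    by (simp add: sgn_div_norm nrm linear_scale[OF lin])
  finally show ?case by (simp add: gram_schmidt_residual)
qed

lemma gram_schmidt_measurable [measurable (raw)]:
  fixes X :: "nat \<Rightarrow> 'a \<Rightarrow> 'v::euclidean_space"
  assumes [measurable]: "\<And>i. X i \<in> borel_measurable M"
  shows "(\<lambda>\<omega>. gram_schmidt (\<lambda>i. X i \<omega>) j) \<in> borel_measurable M"
proof (induction j rule: less_induct)
  case (less j)
  then have [measurable]: "(\<lambda>\<omega>. \<Sum>i<j. (X j \<omega> \<bullet> gram_schmidt (\<lambda>i. X i \<omega>) i) *\<^sub>R gram_schmidt (\<lambda>i. X i \<omega>) i) \<in> borel_measurable M"
    by (intro borel_measurable_sum borel_measurable_scaleR borel_measurable_inner) auto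
  show ?case by (subst gram_schmidt.simps) (simp add: sgn_div_norm)
qed

section \<open>Orthonormal completions and orthogonal maps\<close>

lemma orthonormal_basis_extension:
  fixes F :: "'v::euclidean_space set"
  assumes "pairwise orthogonal F" "\<And>f. f \<in> F \<Longrightarrow> norm f = 1"
  obtains B where "F \<subseteq> B" "pairwise orthogonal B" "\<And>b. b \<in> B \<Longrightarrow> norm b = 1" "finite B" "card B = DIM('v)"
proof -
  obtain U where U: "U \<inter> insert 0 F = {}" "pairwise orthogonal (F \<union> U)" "span (F \<union> U) = span (F \<union> UNIV)"
    using orthogonal_extension_strong[OF assms(1)] by blast
  define B where "B = (\<lambda>x. x /\<^sub>R norm x) ` (F \<union> U)"
  have nz: "x \<noteq> 0" if "x \<in> F \<union> U" for x using that U(1) assms(2)[of x] by auto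
  have "x /\<^sub>R norm x = x" if "x \<in> F" for x using assms(2)[OF that] by simp
  then have FB: "F \<subseteq> B" by (force simp: B_def)
  have orth: "pairwise orthogonal B"
    unfolding pairwise_def
  proof (intro ballI impI)
    fix a b assume "a \<in> B" "b \<in> B" "a \<noteq> b"
    then obtain x y where xy: "x \<in> F \<union> U" "y \<in> F \<union> U" "a = x /\<^sub>R norm x" "b = y /\<^sub>R norm y" "x \<noteq> y"
      unfolding B_def by blast
    then have "x \<bullet> y = 0" using U(2) by (simp add: pairwise_def orthogonal_def)
    then show "orthogonal a b" by (simp add: xy orthogonal_def)
  qed
  have nrm: "norm b = 1" if "b \<in> B" for b using that nz by (auto simp: B_def)
  then have indep: "independent B" using orth by (intro pairwise_orthogonal_independent) force+
  have "F \<union> U \<subseteq> span B"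
  proof
    fix x assume x: "x \<in> F \<union> U"
    then have "norm x *\<^sub>R (x /\<^sub>R norm x) \<in> span B" unfolding B_def by (intro span_scale span_base) auto
    then show "x \<in> span B" using nz[OF x] by simp
  qed
  then have "span (F \<union> U) \<subseteq> span B" by (simp add: span_minimal)
  then have "span B = UNIV" using U(3) by auto
  then have "card B = DIM('v)" using indep by (metis dim_UNIV dim_eq_card_independent dim_span)
  then show ?thesis using that FB orth nrm indep independent_imp_finite by blast
qed

lemma orthonormal_inner:
  assumes "pairwise orthogonal B" "\<And>b. b \<in> B \<Longrightarrow> norm b = 1" "b \<in> B" "c \<in> B"
  shows "b \<bullet> c = (if b = c then 1 else 0)"
  using assms by (auto simp: pairwise_def orthogonal_def simp flip: power2_norm_eq_inner)

text \<open>The remaining basis vectors are matched arbitrarily with the remaining vectors of an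
  orthonormal completion of \<open>F\<close>; both leftovers have the same size.\<close>

lemma orthogonal_transformation_from_Basis:
  fixes B F :: "'v::euclidean_space set"
  assumes F: "pairwise orthogonal F" "\<And>f. f \<in> F \<Longrightarrow> norm f = 1"
    and B: "B \<subseteq> Basis" and h: "bij_betw h B F"
  obtains T where "orthogonal_transformation T" "\<And>b. b \<in> B \<Longrightarrow> T b = h b"
proof -
  obtain F' where F': "F \<subseteq> F'" "pairwise orthogonal F'" "\<And>b. b \<in> F' \<Longrightarrow> norm b = 1" "finite F'" "card F' = DIM('v)"
    using orthonormal_basis_extension[OF F] by blast
  have fin: "finite B" "finite F" using B F' finite_subset finite_Basis by metis+
  have "card (Basis - B) = card (F' - F)"
    using B F' fin bij_betw_same_card[OF h] by (simp add: card_Diff_subset)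
  then obtain h' where h': "bij_betw h' (Basis - B) (F' - F)"
    using F' by (meson finite_Basis finite_Diff finite_same_card_bij)
  define k where "k b = (if b \<in> B then h b else h' b)" for b
  have "bij_betw k (B \<union> (Basis - B)) (F \<union> (F' - F))"
    unfolding k_def using h h' by (intro bij_betw_disjoint_Un) auto
  then have k: "bij_betw k Basis F'" using B F' by (simp add: Un_absorb1)
  then have kF: "k b \<in> F'" if "b \<in> Basis" for b using that by (auto simp: bij_betw_def)
  define T where "T x = (\<Sum>b\<in>Basis. (x \<bullet> b) *\<^sub>R k b)" for x
  have kk: "k b \<bullet> k c = (if b = c then 1 else 0)" if "b \<in> Basis" "c \<in> Basis" for b c
    using orthonormal_inner[OF F'(2,3) kF[OF that(1)] kF[OF that(2)]] k that
    by (auto simp: bij_betw_def inj_on_def)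
  have "linear T" unfolding T_def
    by (intro linear_compose_sum ballI linearI) (auto simp: inner_add_left scaleR_add_left)
  moreover have "T x \<bullet> T y = x \<bullet> y" for x y
  proof -
    have "T x \<bullet> T y = (\<Sum>b\<in>Basis. \<Sum>c\<in>Basis. (x \<bullet> b) * ((y \<bullet> c) * (k b \<bullet> k c)))"
      unfolding T_def inner_sum_left by (intro sum.cong refl) (simp add: inner_sum_right sum_distrib_left ac_simps)
    also have "\<dots> = (\<Sum>b\<in>Basis. (x \<bullet> b) * (y \<bullet> b))"
      by (intro sum.cong refl) (simp add: kk if_distrib cong: if_cong)
    finally show ?thesis by (simp add: euclidean_inner[of x y])
  qed
  moreover have "T b = h b" if "b \<in> B" for b
    using that B by (auto simp: T_def inner_Basis subset_iff k_def if_distrib[of "\<lambda>z. z *\<^sub>R _"] cong: if_cong)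
  ultimately show ?thesis using that by (auto simp: orthogonal_transformation_def)
qed

section \<open>Residuals of independent Gaussian vectors\<close>

text \<open>The earlier frame vectors ignore coordinate \<open>j\<close>. With them fixed, the
  residual is linear in \<open>g\<close> and can be integrated in this one variable.\<close>

lemma residual_update:
  "gs_residual (y(j := g)) j = g - (\<Sum>i<j. (g \<bullet> gram_schmidt y i) *\<^sub>R gram_schmidt y i)"
proof -
  have "gram_schmidt (y(j := g)) i = gram_schmidt y i" if "i < j" for i
    using that by (intro gram_schmidt_cong) auto
  then show ?thesis by (simp add: gs_residual_def)
qed

lemma residual_cong: "(\<And>i. i \<le> j \<Longrightarrow> x i = y i) \<Longrightarrow> gs_residual x j = gs_residual y j"
  unfolding gs_residual_def by (intro arg_cong2[where f=minus] sum.cong) (auto cong: gram_schmidt_cong)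

text \<open>\<open>T\<close> turns \<open>DIM('v) - j\<close> coordinate axes into the orthogonal
  complement of the earlier frame vectors. If some of these vanish the complement is larger than
  that, so the selected coordinates only bound the residual from below.\<close>

lemma residual_rotation:
  fixes y :: "nat \<Rightarrow> 'v::euclidean_space"
  assumes "j \<le> DIM('v)"
  obtains T :: "'v \<Rightarrow> 'v" and B where "orthogonal_transformation T" "B \<subseteq> Basis" "card B = DIM('v) - j"
    "\<And>g. sqrt (\<Sum>b\<in>B. (g \<bullet> b)\<^sup>2) \<le> norm (gs_residual (y(j := T g)) j)"
proof -
  define A where "A = gram_schmidt y ` {..<j}"
  define S where "S = {x. \<forall>v \<in> span A. orthogonal v x}"
  have S: "subspace S" unfolding S_def by (rule subspace_orthogonal_to_vectors)
  have "dim S + dim (span A) = dim (UNIV :: 'v set)"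
    using dim_subspace_orthogonal_to_vectors[of "span A" "UNIV :: 'v set"] by (simp add: S_def)
  moreover have "dim (span A) \<le> j"
    using dim_le_card[of A A] card_image_le[of "{..<j}" "gram_schmidt y"] by (simp add: A_def span_superset dim_span)
  ultimately have dS: "DIM('v) - j \<le> dim S" by simp
  obtain F' where F': "F' \<subseteq> S" "pairwise orthogonal F'" "\<And>x. x \<in> F' \<Longrightarrow> norm x = 1" "independent F'" "card F' = dim S"
    using orthonormal_basis_subspace[OF S] by metis
  obtain F where F: "F \<subseteq> F'" "card F = DIM('v) - j" "finite F"
    using dS F'(5) obtain_subset_with_card_n[of "DIM('v) - j" F'] by metis
  obtain B where B: "B \<subseteq> (Basis :: 'v set)" "card B = DIM('v) - j" "finite B"
    using obtain_subset_with_card_n[of "DIM('v) - j" "Basis :: 'v set"] by (metis diff_le_self)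
  obtain h where h: "bij_betw h B F" using F B finite_same_card_bij by metis
  have Fo: "pairwise orthogonal F" using F' F by (meson pairwise_subset)
  obtain T where T: "orthogonal_transformation T" "\<And>b. b \<in> B \<Longrightarrow> T b = h b"
    using orthogonal_transformation_from_Basis[OF Fo _ B(1) h] F'(3) F(1) by blast
  have inn: "T x \<bullet> T z = x \<bullet> z" for x z using T(1) by (simp add: orthogonal_transformation_def)
  have "sqrt (\<Sum>b\<in>B. (g \<bullet> b)\<^sup>2) \<le> norm (gs_residual (y(j := T g)) j)" for g
  proof -
    define r where "r = gs_residual (y(j := T g)) j"
    obtain r' where r': "r = T r'" using orthogonal_transformation_surj[OF T(1)] by (metis surjD)
    have "r' \<bullet> b = g \<bullet> b" if "b \<in> B" for b
    proof -
      \<comment> \<open>Directions in \<open>S\<close> do not see the projection subtracted in the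
        residual, so the coordinates of \<open>g\<close> in \<open>B\<close> survive.\<close>
      have "T b \<in> S" using T(2) that h F F' by (auto simp: bij_betw_def)
      then have "gram_schmidt y i \<bullet> T b = 0" if "i < j" for i
        using that by (auto simp: S_def A_def orthogonal_def intro: span_base)
      then have "r \<bullet> T b = T g \<bullet> T b" unfolding r_def residual_update
        by (simp add: inner_diff_left inner_sum_left)
      then show ?thesis by (simp add: r' inn)
    qed
    then have "(\<Sum>b\<in>B. (g \<bullet> b)\<^sup>2) = (\<Sum>b\<in>B. (r' \<bullet> b)\<^sup>2)" by simp
    also have "\<dots> \<le> (\<Sum>b\<in>Basis. (r' \<bullet> b)\<^sup>2)" using B by (intro sum_mono2) auto
    also have "\<dots> = (norm r)\<^sup>2"
      unfolding power2_norm_eq_inner r' inn by (subst (2) euclidean_inner) (simp add: power2_eq_square)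
    finally show ?thesis unfolding r_def by (intro real_le_lsqrt) (auto intro: sum_nonneg)
  qed
  then show ?thesis using that T(1) B by blast
qed

lemma residual_measurable [measurable (raw)]:
  fixes X :: "nat \<Rightarrow> 'a \<Rightarrow> 'v::euclidean_space"
  assumes [measurable]: "\<And>i. X i \<in> borel_measurable M"
  shows "(\<lambda>\<omega>. gs_residual (\<lambda>i. X i \<omega>) j) \<in> borel_measurable M"
  unfolding gs_residual_def by measurable

lemma residual_update_measurable [measurable]:
  fixes y :: "nat \<Rightarrow> 'v::euclidean_space"
  shows "(\<lambda>g. gs_residual (y(j := g)) j) \<in> borel_measurable borel"
  unfolding residual_update by measurable

lemma orthogonal_transformation_measurable:
  fixes T :: "'v::euclidean_space \<Rightarrow> 'v"
  assumes "orthogonal_transformation T" shows "T \<in> borel_measurable borel"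
  using assms by (intro borel_measurable_continuous_onI linear_continuous_on linear_conv_bounded_linear[THEN iffD1])
    (simp add: orthogonal_transformation_linear)

lemma nn_integral_gauss_orthogonal:
  fixes T :: "'v::euclidean_space \<Rightarrow> 'v"
  assumes T: "orthogonal_transformation T" and [measurable]: "f \<in> borel_measurable borel"
  shows "(\<integral>\<^sup>+g. f (T g) \<partial>gauss) = (\<integral>\<^sup>+g. f g \<partial>gauss)"
proof -
  note [measurable] = orthogonal_transformation_measurable[OF T]
  show ?thesis by (subst (2) distr_gauss_orthogonal[OF T, symmetric]) (simp add: nn_integral_distr)
qed

text \<open>Rotation invariance removes \<open>T\<close>, leaving a chi mean with
  \<open>DIM('v) - j\<close> degrees of freedom. The bound is uniform in \<open>y\<close>, so it
  survives integration over the other vectors.\<close>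

lemma residual_mean:
  fixes y :: "nat \<Rightarrow> 'v::euclidean_space"
  assumes "j < DIM('v)"
  shows "ennreal (sqrt (real (DIM('v) - j) - 1/2)) \<le> (\<integral>\<^sup>+g. ennreal (norm (gs_residual (y(j := g)) j)) \<partial>gauss)"
proof -
  obtain T :: "'v \<Rightarrow> 'v" and B where T: "orthogonal_transformation T" "B \<subseteq> Basis" "card B = DIM('v) - j"
    "\<And>g. sqrt (\<Sum>b\<in>B. (g \<bullet> b)\<^sup>2) \<le> norm (gs_residual (y(j := T g)) j)"
    using residual_rotation[of j] assms less_imp_le by metis
  have "ennreal (sqrt (real (DIM('v) - j) - 1/2)) \<le> ennreal (chi_mean (card B))"
    unfolding T(3) using assms by (intro ennreal_leI chi_mean_lower) simp
  also have "\<dots> = (\<integral>\<^sup>+g. ennreal (sqrt (\<Sum>b\<in>B. (g \<bullet> b)\<^sup>2)) \<partial>gauss)"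
    by (rule gauss_chi_mean[OF T(2), symmetric])
  also have "\<dots> \<le> (\<integral>\<^sup>+g. ennreal (norm (gs_residual (y(j := T g)) j)) \<partial>gauss)"
    by (intro nn_integral_mono ennreal_leI T(4))
  also have "\<dots> = (\<integral>\<^sup>+g. ennreal (norm (gs_residual (y(j := g)) j)) \<partial>gauss)"
    by (rule nn_integral_gauss_orthogonal[OF T(1)]) measurable
  finally show ?thesis .
qed

lemma AE_gauss_inner_nonzero:
  assumes "b \<in> (Basis :: 'v::euclidean_space set)"
  shows "AE g in gauss. g \<bullet> b \<noteq> 0"
proof -
  have "{x. x \<bullet> b = 0} \<in> null_sets lebesgue"
    using negligible_standard_hyperplane[OF assms, of 0] by (simp add: negligible_iff_null_sets)
  moreover have "{x. x \<bullet> b = 0} \<in> sets lborel" by measurable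
  ultimately have "{x. x \<bullet> b = 0} \<in> null_sets lborel" using null_sets_completion_iff by blast
  then have "AE g in lborel. g \<bullet> b \<noteq> 0" by (rule AE_I') auto
  then show ?thesis unfolding gauss_eq_density by (subst AE_density) auto
qed

text \<open>A vanishing residual forces, after a rotation, \<open>g \<bullet> b = 0\<close> for
  every \<open>b \<in> B\<close>. As \<open>j < DIM('v)\<close> the set \<open>B\<close> is
  nonempty, and a coordinate hyperplane is a null set.\<close>

lemma residual_nonzero:
  fixes y :: "nat \<Rightarrow> 'v::euclidean_space"
  assumes "j < DIM('v)"
  shows "AE g in gauss. gs_residual (y(j := g)) j \<noteq> 0"
proof -
  obtain T :: "'v \<Rightarrow> 'v" and B where T: "orthogonal_transformation T" "B \<subseteq> Basis" "card B = DIM('v) - j"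
    "\<And>g. sqrt (\<Sum>b\<in>B. (g \<bullet> b)\<^sup>2) \<le> norm (gs_residual (y(j := T g)) j)"
    using residual_rotation[of j] assms less_imp_le by metis
  note [measurable] = orthogonal_transformation_measurable[OF T(1)]
  obtain b where b: "b \<in> B" using T(3) assms by (metis all_not_in_conv card.empty zero_less_diff less_irrefl)
  have "finite B" using T(2) finite_Basis finite_subset by blast
  have "AE g in gauss. gs_residual (y(j := T g)) j \<noteq> 0"
  proof -
    have *: "gs_residual (y(j := T g)) j \<noteq> 0" if "g \<bullet> b \<noteq> 0" for g
    proof
      assume "gs_residual (y(j := T g)) j = 0"
      then have "(\<Sum>b\<in>B. (g \<bullet> b)\<^sup>2) \<le> 0" using T(4)[of g] by simp
      then have "(\<Sum>b\<in>B. (g \<bullet> b)\<^sup>2) = 0" by (intro antisym sum_nonneg) auto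
      then show False using that b \<open>finite B\<close> by (simp add: sum_nonneg_eq_0_iff)
    qed
    have "AE g in gauss. g \<bullet> b \<noteq> 0" using AE_gauss_inner_nonzero[of b] b T(2) by blast
    then show ?thesis by eventually_elim (rule *)
  qed
  then have "AE g in distr gauss borel T. gs_residual (y(j := g)) j \<noteq> 0"
    by (subst AE_distr_iff) auto
  then show ?thesis unfolding distr_gauss_orthogonal[OF T(1)] .
qed

text \<open>The sum of absolute coordinates dominates the norm, and each of its terms has the finite
  mean \<open>chi_mean 1\<close>.\<close>

lemma integrable_gauss_norm: "integrable gauss (norm :: 'v::euclidean_space \<Rightarrow> real)"
proof (rule Bochner_Integration.integrable_bound)
  have "integrable gauss (\<lambda>g. \<bar>g \<bullet> b\<bar>)" if "b \<in> Basis" for b :: 'v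
    using gauss_chi_mean[of "{b}"] that by (intro integrableI_nonneg) auto
  then show "integrable gauss (\<lambda>g::'v. \<Sum>b\<in>Basis. \<bar>g \<bullet> b\<bar>)" by (rule Bochner_Integration.integrable_sum)
  show "AE g::'v in gauss. norm (norm g) \<le> norm (\<Sum>b\<in>Basis. \<bar>g \<bullet> b\<bar>)"
    using norm_le_l1 by (auto intro!: AE_I2 intro: order_trans[OF _ abs_ge_self])
qed auto

section \<open>Families of independent Gaussian vectors\<close>

abbreviation gauss_family :: "('k \<Rightarrow> 'v::euclidean_space) measure"
  where "gauss_family \<equiv> PiM UNIV (\<lambda>_. gauss)"

lemma prob_space_gauss_family: "prob_space gauss_family"
  by (intro prob_space_PiM prob_space_gauss)

lemma product_prob_space_gauss: "product_prob_space (\<lambda>_. gauss)"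
proof -
  interpret prob_space gauss by (rule prob_space_gauss)
  show ?thesis by unfold_locales
qed

lemma measurable_gauss_family_component [measurable]:
  "(\<lambda>x. x i) \<in> borel_measurable gauss_family"
  using measurable_component_singleton[of i UNIV "\<lambda>_. gauss"] by (simp cong: measurable_cong_sets)

lemma integrable_gauss_family:
  "integrable gauss_family (\<lambda>x::'k \<Rightarrow> 'v::euclidean_space. norm (x i))"
proof -
  have "distr gauss_family (gauss :: 'v measure) (\<lambda>x. x i) = gauss"
    using distr_PiM_component[of UNIV "\<lambda>_. gauss :: 'v measure" i] prob_space_gauss by blast
  then have "integrable (distr gauss_family (gauss :: 'v measure) (\<lambda>x. x i)) norm" using integrable_gauss_norm by simp
  then show ?thesis by (subst (asm) integrable_distr_eq) (auto cong: measurable_cong_sets)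
qed

lemma nn_integral_gauss_family_split:
  fixes f :: "('k::finite \<Rightarrow> 'v::euclidean_space) \<Rightarrow> ennreal"
  assumes [measurable]: "f \<in> borel_measurable gauss_family"
  shows "(\<integral>\<^sup>+x. f x \<partial>gauss_family) = (\<integral>\<^sup>+x. (\<integral>\<^sup>+g. f (x(i := g)) \<partial>gauss) \<partial>PiM (UNIV - {i}) (\<lambda>_. gauss))"
proof -
  interpret product_prob_space "\<lambda>_::'k. gauss :: 'v measure" by (rule product_prob_space_gauss)
  have "insert i (UNIV - {i}) = UNIV" by auto
  then show ?thesis using product_nn_integral_insert[of "UNIV - {i}" i f] by simp
qed

context
  fixes e :: "nat \<Rightarrow> 'k::finite" and K :: nat
  assumes e: "inj_on e {..<K}"
begin

text \<open>Gram-Schmidt needs an order on the columns, which \<open>e\<close> supplies; by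
  injectivity a change of column \<open>e j\<close> affects no earlier vector of the
  enumeration.\<close>

lemma residual_enum_update:
  assumes "j < K"
  shows "gs_residual (\<lambda>i. (x(e j := g)) (e i)) j = gs_residual ((\<lambda>i. x (e i))(j := g)) j"
  using assms e by (intro residual_cong) (auto simp: inj_on_def)

text \<open>Column \<open>e j\<close> is integrated first, with all others fixed. Integrability
  holds because the residual is no longer than the column itself, by Cauchy-Schwarz.\<close>

lemma gauss_family_residual_mean:
  assumes j: "j < K" "K \<le> DIM('v::euclidean_space)"
  shows "integrable gauss_family (\<lambda>x :: 'k \<Rightarrow> 'v. norm (gs_residual (\<lambda>i. x (e i)) j))"
    and "sqrt (real (DIM('v) - j) - 1/2) \<le> (\<integral>x. norm (gs_residual (\<lambda>i. x (e i)) j) \<partial>(gauss_family :: ('k \<Rightarrow> 'v) measure))"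
proof -
  let ?M = "gauss_family :: ('k \<Rightarrow> 'v) measure"
  let ?r = "\<lambda>x :: 'k \<Rightarrow> 'v. norm (gs_residual (\<lambda>i. x (e i)) j)"
  interpret prob_space "PiM (UNIV - {e j}) (\<lambda>_. gauss) :: ('k \<Rightarrow> 'v) measure"
    by (intro prob_space_PiM prob_space_gauss)
  have "?r x \<le> norm (x (e j))" for x
    using norm_cauchy_schwarz[of "x (e j)" "gram_schmidt (\<lambda>i. x (e i)) j"]
      inner_gram_schmidt_same[of "\<lambda>i. x (e i)" j]
    by (auto simp: norm_gram_schmidt split: if_splits)
  then show int: "integrable ?M ?r"
    by (intro Bochner_Integration.integrable_bound[OF integrable_gauss_family[of "e j"]]) auto
  have "ennreal (sqrt (real (DIM('v) - j) - 1/2))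
      = (\<integral>\<^sup>+x. ennreal (sqrt (real (DIM('v) - j) - 1/2)) \<partial>(PiM (UNIV - {e j}) (\<lambda>_. gauss) :: ('k \<Rightarrow> 'v) measure))"
    by (simp add: emeasure_space_1)
  also have "\<dots> \<le> (\<integral>\<^sup>+x. (\<integral>\<^sup>+g. ennreal (?r (x(e j := g))) \<partial>gauss) \<partial>PiM (UNIV - {e j}) (\<lambda>_. gauss))"
    unfolding residual_enum_update[OF j(1)] using j by (intro nn_integral_mono residual_mean) auto
  also have "\<dots> = (\<integral>\<^sup>+x. ennreal (?r x) \<partial>?M)"
    by (rule nn_integral_gauss_family_split[symmetric]) measurable
  also have "\<dots> = ennreal (\<integral>x. ?r x \<partial>?M)"
    by (intro nn_integral_eq_integral int) auto
  finally show "sqrt (real (DIM('v) - j) - 1/2) \<le> (\<integral>x. ?r x \<partial>?M)"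
    by (simp add: ennreal_le_iff integral_nonneg_AE)
qed

lemma gauss_family_residual_nonzero:
  assumes "K \<le> DIM('v::euclidean_space)"
  shows "AE x :: 'k \<Rightarrow> 'v in gauss_family. \<forall>j<K. gs_residual (\<lambda>i. x (e i)) j \<noteq> 0"
proof -
  have "AE x :: 'k \<Rightarrow> 'v in gauss_family. gs_residual (\<lambda>i. x (e i)) j \<noteq> 0" if j: "j < K" for j
  proof -
    \<comment> \<open>The exceptional event is written as an integral so that Tonelli's theorem can
      isolate column \<open>e j\<close>.\<close>
    let ?f = "\<lambda>v :: 'v. indicator {0} v :: ennreal"
    have "(\<integral>\<^sup>+x. ?f (gs_residual (\<lambda>i. x (e i)) j) \<partial>(gauss_family :: ('k \<Rightarrow> 'v) measure))
       = (\<integral>\<^sup>+x. (\<integral>\<^sup>+g. ?f (gs_residual (\<lambda>i. (x(e j := g)) (e i)) j) \<partial>gauss) \<partial>PiM (UNIV - {e j}) (\<lambda>_. gauss))"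
      by (rule nn_integral_gauss_family_split) measurable
    also have "\<dots> = (\<integral>\<^sup>+x. 0 \<partial>(PiM (UNIV - {e j}) (\<lambda>_. gauss) :: ('k \<Rightarrow> 'v) measure))"
    proof (rule nn_integral_cong)
      fix x :: "'k \<Rightarrow> 'v"
      have "AE g in gauss. ?f (gs_residual ((\<lambda>i. x (e i))(j := g)) j) = 0"
        using residual_nonzero[of j "\<lambda>i. x (e i)"] j assms by (auto elim: eventually_mono)
      then show "(\<integral>\<^sup>+g. ?f (gs_residual (\<lambda>i. (x(e j := g)) (e i)) j) \<partial>gauss) = 0"
        unfolding residual_enum_update[OF j] using nn_integral_cong_AE by fastforce
    qed
    finally have "(\<integral>\<^sup>+x. ?f (gs_residual (\<lambda>i. x (e i)) j) \<partial>(gauss_family :: ('k \<Rightarrow> 'v) measure)) = 0"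
      by simp
    then have "AE x :: 'k \<Rightarrow> 'v in gauss_family. ?f (gs_residual (\<lambda>i. x (e i)) j) = 0"
      by (subst (asm) nn_integral_0_iff_AE) auto
    then show ?thesis by eventually_elim (auto simp: indicator_def split: if_splits)
  qed
  then have "AE x :: 'k \<Rightarrow> 'v in gauss_family. \<forall>j\<in>{..<K}. gs_residual (\<lambda>i. x (e i)) j \<noteq> 0"
    by (intro AE_finite_allI) auto
  then show ?thesis by auto
qed

end

text \<open>The rotation may differ from column to column. A constant one gives left multiplication
  by an orthogonal matrix, and multiplication by \<plusminus>1 gives the sign changes of
  columns.\<close>

lemma nn_integral_gauss_family_componentwise:
  fixes f :: "('k::finite \<Rightarrow> 'v::euclidean_space) \<Rightarrow> ennreal" and T :: "'k \<Rightarrow> 'v \<Rightarrow> 'v"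
  assumes T: "\<And>i. orthogonal_transformation (T i)" and [measurable]: "f \<in> borel_measurable gauss_family"
  shows "(\<integral>\<^sup>+x. f (\<lambda>i. T i (x i)) \<partial>gauss_family) = (\<integral>\<^sup>+x. f x \<partial>gauss_family)"
proof -
  interpret product_prob_space "\<lambda>_::'k. gauss :: 'v measure" by (rule product_prob_space_gauss)
  note [measurable] = orthogonal_transformation_measurable[OF T]
  have m [measurable]: "(\<lambda>x i. T i (x i)) \<in> measurable gauss_family gauss_family"
    by (rule measurable_PiM_single') (auto simp: space_PiM)
  have "distr gauss_family gauss_family (\<lambda>x i. T i (x i)) = gauss_family"
  proof (rule PiM_eqI)
    fix A :: "'k \<Rightarrow> 'v set" assume "\<And>i. i \<in> UNIV \<Longrightarrow> A i \<in> sets gauss"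
    then have A [measurable]: "A i \<in> sets borel" for i by simp
    have "(\<lambda>x i. T i (x i)) -` Pi\<^sub>E UNIV A \<inter> space gauss_family = Pi\<^sub>E UNIV (\<lambda>i. T i -` A i)"
      by (auto simp: space_PiM)
    moreover have TA: "T i -` A i \<in> sets borel" for i using measurable_sets[of "T i" borel borel "A i"] by simp
    moreover have "emeasure gauss (T i -` A i) = emeasure gauss (A i)" for i
    proof -
      have "emeasure (distr gauss borel (T i)) (A i) = emeasure gauss (T i -` A i)"
        using orthogonal_transformation_measurable[OF T, of i] by (subst emeasure_distr) (auto cong: measurable_cong_sets)
      then show ?thesis by (simp add: distr_gauss_orthogonal[OF T])
    qed
    ultimately show "emeasure (distr gauss_family gauss_family (\<lambda>x i. T i (x i))) (Pi\<^sub>E UNIV A) = (\<Prod>i\<in>UNIV. emeasure gauss (A i))"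
      by (subst emeasure_distr) (auto intro!: sets_PiM_I_finite simp: emeasure_PiM)
  qed auto
  then have "(\<integral>\<^sup>+x. f x \<partial>gauss_family) = (\<integral>\<^sup>+x. f x \<partial>distr gauss_family gauss_family (\<lambda>x i. T i (x i)))"
    by simp
  then show ?thesis by (simp add: nn_integral_distr[OF m])
qed

lemma nn_integral_gauss_family_permute:
  fixes f :: "('k::finite \<Rightarrow> 'v::euclidean_space) \<Rightarrow> ennreal" and \<pi> :: "'k \<Rightarrow> 'k"
  assumes "bij \<pi>" and [measurable]: "f \<in> borel_measurable gauss_family"
  shows "(\<integral>\<^sup>+x. f (\<lambda>i. x (\<pi> i)) \<partial>gauss_family) = (\<integral>\<^sup>+x. f x \<partial>gauss_family)"
proof -
  have m [measurable]: "(\<lambda>x i. x (\<pi> i)) \<in> measurable gauss_family gauss_family"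
    by (rule measurable_PiM_single') (auto simp: space_PiM)
  have "distr gauss_family gauss_family (\<lambda>x. \<lambda>n\<in>UNIV. x (\<pi> n)) = (gauss_family :: ('k \<Rightarrow> 'v) measure)"
    using assms(1) by (intro distr_PiM_reindex prob_space_gauss) (auto simp: bij_def)
  then show ?thesis by (simp add: nn_integral_distr[OF m, symmetric] restrict_UNIV)
qed

section \<open>Independence of the orthogonal and triangular factors\<close>

lemma borel_measurable_matrix_iff:
  fixes A :: "'a \<Rightarrow> real ^ 'k ^ 'n"
  shows "A \<in> borel_measurable M \<longleftrightarrow> (\<forall>i j. (\<lambda>\<omega>. A \<omega> $ i $ j) \<in> borel_measurable M)"
proof
  assume A: "A \<in> borel_measurable M"
  have "(\<lambda>B :: real ^ 'k ^ 'n. B $ i $ j) \<in> borel_measurable borel" for i j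
    by (intro borel_measurable_continuous_onI continuous_intros)
  from measurable_compose[OF A this] show "\<forall>i j. (\<lambda>\<omega>. A \<omega> $ i $ j) \<in> borel_measurable M" by blast
next
  assume *: "\<forall>i j. (\<lambda>\<omega>. A \<omega> $ i $ j) \<in> borel_measurable M"
  show "A \<in> borel_measurable M"
    by (rule borel_measurable_euclidean_space[THEN iffD2])
      (use * in \<open>auto simp: Basis_vec_def inner_axis\<close>)
qed

lemma borel_measurable_matrix_mult [measurable (raw)]:
  fixes A :: "'a \<Rightarrow> real ^ 'k ^ 'n" and B :: "'a \<Rightarrow> real ^ 'm ^ 'k"
  assumes A: "A \<in> borel_measurable M" and B: "B \<in> borel_measurable M"
  shows "(\<lambda>\<omega>. A \<omega> ** B \<omega>) \<in> borel_measurable M"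
  using A[unfolded borel_measurable_matrix_iff] B[unfolded borel_measurable_matrix_iff]
  unfolding borel_measurable_matrix_iff matrix_matrix_mult_def
  by (auto intro!: borel_measurable_sum borel_measurable_times)

lemma orthogonal_transformation_matrix_vector:
  fixes U :: "real ^ 'n ^ 'n"
  assumes "orthogonal_matrix U" shows "orthogonal_transformation ((*v) U)"
  using assms by (simp add: orthogonal_transformation_matrix matrix_vector_mul_linear)

text \<open>Both frames are images of the same standard basis vectors under orthogonal maps.\<close>
lemma stiefel_transitive:
  fixes A B :: "real ^ 'k ^ 'n"
  assumes "CARD('k) \<le> CARD('n)" and A: "A \<in> stiefel" and B: "B \<in> stiefel"
  obtains U where "orthogonal_matrix U" "A = U ** B"
proof -
  obtain \<beta> :: "'k \<Rightarrow> real ^ 'n" where \<beta>: "inj \<beta>" "range \<beta> \<subseteq> Basis"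
    using assms(1) card_le_inj[of "UNIV :: 'k set" "Basis :: (real^'n) set"] by auto
  have frame: "\<exists>T. orthogonal_transformation T \<and> (\<forall>j. T (\<beta> j) = column j C)" if C: "C \<in> stiefel" for C :: "real ^ 'k ^ 'n"
  proof -
    have inn: "column i C \<bullet> column j C = (if i = j then 1 else 0)" for i j
    proof -
      have "(transpose C ** C) $ i $ j = column i C \<bullet> column j C"
        by (simp add: matrix_matrix_mult_def transpose_def column_def inner_vec_def)
      then show ?thesis using C by (simp add: stiefel_def mat_def)
    qed
    let ?F = "range (\<lambda>j. column j C)"
    have 1: "pairwise orthogonal ?F" by (auto simp: pairwise_def orthogonal_def inn split: if_splits)
    have 2: "norm f = 1" if "f \<in> ?F" for f using that inn by (auto simp: norm_eq_sqrt_inner)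
    have "inj (\<lambda>j. column j C)"
      by (rule injI) (metis inn zero_neq_one)
    then have "bij_betw (\<lambda>j. column j C) UNIV ?F" by (rule inj_on_imp_bij_betw)
    moreover have "bij_betw (inv \<beta>) (range \<beta>) UNIV"
      by (rule bij_betw_inv_into[OF inj_on_imp_bij_betw[OF \<beta>(1)]])
    ultimately have "bij_betw ((\<lambda>j. column j C) \<circ> inv \<beta>) (range \<beta>) ?F" using bij_betw_trans by blast
    from orthogonal_transformation_from_Basis[OF 1 2 \<beta>(2) this] show ?thesis
      using \<beta>(1) by (metis comp_apply inv_f_f rangeI)
  qed
  obtain T where T: "orthogonal_transformation T" "\<And>j. T (\<beta> j) = column j A" using frame[OF A] by blast
  obtain T' where T': "orthogonal_transformation T'" "\<And>j. T' (\<beta> j) = column j B" using frame[OF B] by blast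
  define U where "U = matrix (T \<circ> inv T')"
  have o: "orthogonal_transformation (T \<circ> inv T')"
    by (intro orthogonal_transformation_compose orthogonal_transformation_inv T T')
  then have "orthogonal_matrix U" by (simp add: U_def orthogonal_transformation_matrix)
  moreover have "A = U ** B"
  proof -
    have "U *v column j B = column j A" for j
    proof -
      have "U *v column j B = (T \<circ> inv T') (column j B)"
        unfolding U_def using o by (intro matrix_works) (simp add: orthogonal_transformation_def linear_matrix_vector_mul_eq)
      also have "\<dots> = T (inv T' (T' (\<beta> j)))" by (simp add: T')
      also have "\<dots> = column j A" using orthogonal_transformation_inj[OF T'(1)] by (simp add: T)
      finally show ?thesis .
    qed
    then have "column j A = column j (U ** B)" for j
      by (simp add: column_def matrix_matrix_mult_def matrix_vector_mult_def vec_eq_iff)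
    then show ?thesis by (simp add: vec_eq_iff column_def)
  qed
  ultimately show ?thesis by (rule that)
qed

section \<open>The Gram-Schmidt factorization of a matrix\<close>

definition column_matrix :: "('k \<Rightarrow> real ^ 'n) \<Rightarrow> real ^ 'k ^ 'n"
  where "column_matrix x = (\<chi> i j. x j $ i)"

lemma column_matrix_measurable [measurable]: "column_matrix \<in> borel_measurable gauss_family"
proof -
  have "(\<lambda>v :: real ^ 'n. v $ i) \<in> borel_measurable borel" for i
    by (intro borel_measurable_continuous_onI continuous_intros)
  then have [measurable]: "(\<lambda>x :: 'k \<Rightarrow> real ^ 'n. x j $ i) \<in> borel_measurable gauss_family" for i j
    by measurable
  show ?thesis unfolding borel_measurable_matrix_iff column_matrix_def by simp
qed

lemma matrix_mult_column_matrix: "U ** column_matrix x = column_matrix (\<lambda>j. U *v x j)"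
  by (simp add: column_matrix_def matrix_matrix_mult_def matrix_vector_mult_def)

lemma nn_integral_column_matrix_orthogonal:
  fixes h :: "real ^ 'k ^ 'n \<Rightarrow> ennreal"
  assumes "orthogonal_matrix U" and [measurable]: "h \<in> borel_measurable borel"
  shows "(\<integral>\<^sup>+x. h (U ** column_matrix x) \<partial>gauss_family) = (\<integral>\<^sup>+x. h (column_matrix x) \<partial>gauss_family)"
  unfolding matrix_mult_column_matrix
  by (intro nn_integral_gauss_family_componentwise[where f="\<lambda>x. h (column_matrix x)"]
      orthogonal_transformation_matrix_vector assms) measurable

context
  fixes e :: "nat \<Rightarrow> 'k::finite"
  assumes e: "bij_betw e {..<CARD('k)} UNIV"
begin

definition gs_frame :: "('k \<Rightarrow> 'v::euclidean_space) \<Rightarrow> 'k \<Rightarrow> 'v"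
  where "gs_frame x b = gram_schmidt (\<lambda>i. x (e i)) (inv_into {..<CARD('k)} e b)"

text \<open>The coefficient matrix of the frame expansion: upper triangular in the order given by
  \<open>e\<close>, with residual norms on the diagonal.\<close>

definition gs_factor :: "('k \<Rightarrow> 'v::euclidean_space) \<Rightarrow> real ^ 'k ^ 'k"
  where "gs_factor x = (\<chi> a b. x b \<bullet> gs_frame x a)"

lemma index_inverse: "e (inv_into {..<CARD('k)} e b) = b" "inv_into {..<CARD('k)} e b < CARD('k)"
  using e by (auto simp: bij_betw_def f_inv_into_f) (metis UNIV_I inv_into_into lessThan_iff)

lemma gs_frame_expansion: "x b = (\<Sum>a\<in>UNIV. (x b \<bullet> gs_frame x a) *\<^sub>R gs_frame x a)"
proof -
  let ?q = "gram_schmidt (\<lambda>i. x (e i))"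
  have "x b = (\<Sum>i<CARD('k). (x b \<bullet> ?q i) *\<^sub>R ?q i)"
    using gram_schmidt_expansion[OF index_inverse(2), of "\<lambda>i. x (e i)" b] by (simp add: index_inverse)
  also have "\<dots> = (\<Sum>i<CARD('k). (x b \<bullet> gs_frame x (e i)) *\<^sub>R gs_frame x (e i))"
    using e by (intro sum.cong) (auto simp: gs_frame_def bij_betw_def inv_into_f_f)
  also have "\<dots> = (\<Sum>a\<in>UNIV. (x b \<bullet> gs_frame x a) *\<^sub>R gs_frame x a)"
    by (rule sum.reindex_bij_betw[OF e])
  finally show ?thesis .
qed

lemma column_matrix_factorization:
  "column_matrix x = column_matrix (gs_frame x) ** gs_factor x"
proof -
  have "x b $ i = (\<Sum>a\<in>UNIV. gs_frame x a $ i * (x b \<bullet> gs_frame x a))" for i b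
    by (subst gs_frame_expansion[of x b]) (simp add: mult.commute)
  then show ?thesis by (simp add: column_matrix_def gs_factor_def matrix_matrix_mult_def vec_eq_iff)
qed

lemma gs_frame_inner:
  assumes "\<forall>j<CARD('k). gs_residual (\<lambda>i. x (e i)) j \<noteq> 0"
  shows "gs_frame x a \<bullet> gs_frame x b = (if a = b then 1 else 0)"
  using assms index_inverse gram_schmidt_inner_self gram_schmidt_orthogonal
  unfolding gs_frame_def by (metis (mono_tags, lifting))

lemma gs_frame_stiefel:
  assumes "\<forall>j<CARD('k). gs_residual (\<lambda>i. x (e i)) j \<noteq> 0"
  shows "column_matrix (gs_frame x) \<in> stiefel"
  using gs_frame_inner[OF assms]
  by (simp add: stiefel_def column_matrix_def matrix_matrix_mult_def transpose_def mat_def vec_eq_iff inner_vec_def)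

lemma gs_frame_equivariant:
  fixes x :: "'k \<Rightarrow> 'v::euclidean_space"
  shows "orthogonal_transformation T \<Longrightarrow> gs_frame (\<lambda>b. T (x b)) a = T (gs_frame x a)"
  unfolding gs_frame_def by (rule gram_schmidt_equivariant)

lemma gs_frame_measurable [measurable]:
  "(\<lambda>x. gs_frame x a) \<in> borel_measurable (gauss_family :: ('k \<Rightarrow> 'v::euclidean_space) measure)"
  unfolding gs_frame_def by measurable

lemma gs_factor_measurable [measurable]:
  "gs_factor \<in> borel_measurable (gauss_family :: ('k \<Rightarrow> 'v::euclidean_space) measure)"
  unfolding borel_measurable_matrix_iff gs_factor_def by simp

end

text \<open>The Gram-Schmidt frame of a square Gaussian matrix serves as a random rotation invariant from the right.\<close>
lemma invariant_rotation_exists: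
  obtains R :: "('n::finite \<Rightarrow> real ^ 'n) \<Rightarrow> real ^ 'n ^ 'n"
  where "R \<in> borel_measurable gauss_family" "AE z in gauss_family. orthogonal_matrix (R z)"
    "\<And>U (h :: real ^ 'n ^ 'n \<Rightarrow> ennreal). orthogonal_matrix U \<Longrightarrow> h \<in> borel_measurable borel \<Longrightarrow>
      (\<integral>\<^sup>+z. h (R z ** U) \<partial>gauss_family) = (\<integral>\<^sup>+z. h (R z) \<partial>gauss_family)"
proof -
  obtain e :: "nat \<Rightarrow> 'n" where e: "bij_betw e {..<CARD('n)} UNIV"
    using ex_bij_betw_nat_finite[of "UNIV :: 'n set"] by (auto simp: atLeast0LessThan)
  note [measurable] = gs_frame_measurable[OF e]
  \<comment> \<open>The frame vectors are taken as rows, so multiplying by \<open>U\<close> from the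
    right applies \<open>transpose U\<close> to each of them and equivariance applies.\<close>
  define R :: "('n \<Rightarrow> real ^ 'n) \<Rightarrow> real ^ 'n ^ 'n" where "R z = (\<chi> i. gs_frame e z i)" for z
  have Rt: "R z = transpose (column_matrix (gs_frame e z))" for z
    by (simp add: R_def column_matrix_def transpose_def vec_eq_iff)
  show thesis
  proof (rule that[of R])
    show meas [measurable]: "R \<in> borel_measurable gauss_family"
    proof -
      have "(\<lambda>v :: real ^ 'n. v $ i) \<in> borel_measurable borel" for i
        by (intro borel_measurable_continuous_onI continuous_intros)
      from measurable_compose[OF gs_frame_measurable[OF e] this]
      show ?thesis unfolding borel_measurable_matrix_iff R_def by simp
    qed
    have "AE z :: 'n \<Rightarrow> real ^ 'n in gauss_family. \<forall>j<CARD('n). gs_residual (\<lambda>i. z (e i)) j \<noteq> 0"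
      using e by (intro gauss_family_residual_nonzero) (auto simp: bij_betw_def)
    then show "AE z in gauss_family. orthogonal_matrix (R z)"
    proof eventually_elim
      case (elim z)
      then show ?case using gs_frame_stiefel[OF e elim] 
        unfolding Rt orthogonal_matrix_transpose by (simp add: stiefel_def orthogonal_matrix)
    qed
    fix U :: "real ^ 'n ^ 'n" and h :: "real ^ 'n ^ 'n \<Rightarrow> ennreal"
    assume U: "orthogonal_matrix U" and [measurable]: "h \<in> borel_measurable borel"
    have T: "orthogonal_transformation ((*v) (transpose U))"
      using U by (intro orthogonal_transformation_matrix_vector) simp
    have "R z ** U = R (\<lambda>i. transpose U *v z i)" for z
      unfolding R_def gs_frame_equivariant[OF e T]
      by (simp add: matrix_matrix_mult_def matrix_vector_mult_def transpose_def vec_eq_iff mult.commute)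
    then show "(\<integral>\<^sup>+z. h (R z ** U) \<partial>gauss_family) = (\<integral>\<^sup>+z. h (R z) \<partial>gauss_family)"
      using nn_integral_gauss_family_componentwise[OF T, of "\<lambda>z. h (R z)"] by simp
  qed
qed

section \<open>Haar measure and the triangular factor\<close>

lemma stiefel_haar_left:
  assumes "stiefel_haar \<mu>" "orthogonal_matrix U" and [measurable]: "h \<in> borel_measurable borel"
  shows "(\<integral>\<^sup>+A. h (U ** A) \<partial>\<mu>) = (\<integral>\<^sup>+A. h A \<partial>\<mu>)"
proof -
  have sets [measurable_cong]: "sets \<mu> = sets borel" and d: "distr \<mu> borel (\<lambda>A. U ** A) = \<mu>"
    using assms by (auto simp: stiefel_haar_def)
  have "(\<lambda>A. U ** A) \<in> borel_measurable \<mu>"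
    by (intro borel_measurable_matrix_mult borel_measurable_const) (rule measurable_ident_sets[OF sets])
  then have "(\<integral>\<^sup>+A. h A \<partial>distr \<mu> borel (\<lambda>A. U ** A)) = (\<integral>\<^sup>+A. h (U ** A) \<partial>\<mu>)"
    by (rule nn_integral_distr) simp
  then show ?thesis by (simp only: d)
qed

lemma stiefel_haar_right:
  assumes "stiefel_haar \<mu>" "orthogonal_matrix V" and [measurable]: "h \<in> borel_measurable borel"
  shows "(\<integral>\<^sup>+A. h (A ** V) \<partial>\<mu>) = (\<integral>\<^sup>+A. h A \<partial>\<mu>)"
proof -
  have sets [measurable_cong]: "sets \<mu> = sets borel" and d: "distr \<mu> borel (\<lambda>A. A ** V) = \<mu>"
    using assms by (auto simp: stiefel_haar_def)
  have "(\<lambda>A. A ** V) \<in> borel_measurable \<mu>"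
    by (intro borel_measurable_matrix_mult borel_measurable_const) (rule measurable_ident_sets[OF sets])
  then have "(\<integral>\<^sup>+A. h A \<partial>distr \<mu> borel (\<lambda>A. A ** V)) = (\<integral>\<^sup>+A. h (A ** V) \<partial>\<mu>)"
    by (rule nn_integral_distr) simp
  then show ?thesis by (simp only: d)
qed

text \<open>For fixed \<open>x\<close>, the integrals of \<open>h (A ** gs_factor e x)\<close> over Haar-distributed \<open>A\<close> and of
  \<open>h (R ** column_matrix x)\<close> over a right-invariant random rotation \<open>R\<close> coincide.
  In other words the orthogonal and triangular factors of a Gaussian matrix are independent.\<close>
lemma stiefel_haar_times_factor:
  fixes \<mu> :: "(real ^ 'k ^ 'n) measure" and h :: "real ^ 'k ^ 'n \<Rightarrow> ennreal"
  assumes card: "CARD('k) \<le> CARD('n)" and e: "bij_betw e {..<CARD('k)} UNIV"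
    and \<mu>: "stiefel_haar \<mu>" and [measurable]: "h \<in> borel_measurable borel"
  shows "(\<integral>\<^sup>+x. (\<integral>\<^sup>+A. h (A ** gs_factor e x) \<partial>\<mu>) \<partial>(gauss_family :: ('k \<Rightarrow> real ^ 'n) measure))
    = (\<integral>\<^sup>+x. h (column_matrix x) \<partial>gauss_family)"
proof -
  obtain R :: "('n \<Rightarrow> real ^ 'n) \<Rightarrow> real ^ 'n ^ 'n" where R [measurable]: "R \<in> borel_measurable gauss_family"
    and Ro: "AE z in gauss_family. orthogonal_matrix (R z)"
    and Rinv: "\<And>U (h :: real ^ 'n ^ 'n \<Rightarrow> ennreal). orthogonal_matrix U \<Longrightarrow> h \<in> borel_measurable borel \<Longrightarrow>
      (\<integral>\<^sup>+z. h (R z ** U) \<partial>gauss_family) = (\<integral>\<^sup>+z. h (R z) \<partial>gauss_family)"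
    using invariant_rotation_exists by metis
  let ?G = "gauss_family :: ('k \<Rightarrow> real ^ 'n) measure" and ?Z = "gauss_family :: ('n \<Rightarrow> real ^ 'n) measure"
  have sets [measurable_cong]: "sets \<mu> = sets borel" and "prob_space \<mu>" and st: "AE A in \<mu>. A \<in> stiefel"
    using \<mu> by (auto simp: stiefel_haar_def)
  interpret mu: prob_space \<mu> by fact
  interpret G: prob_space ?G by (rule prob_space_gauss_family)
  interpret Z: prob_space ?Z by (rule prob_space_gauss_family)
  interpret ZG: pair_sigma_finite ?Z ?G by standard
  interpret Zmu: pair_sigma_finite ?Z \<mu> by standard
  note [measurable] = gs_factor_measurable[OF e]
  have fixed: "(\<integral>\<^sup>+A. h (A ** gs_factor e x) \<partial>\<mu>) = (\<integral>\<^sup>+z. h (R z ** column_matrix x) \<partial>?Z)"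
    if x: "\<forall>j<CARD('k). gs_residual (\<lambda>i. x (e i)) j \<noteq> 0" for x :: "'k \<Rightarrow> real ^ 'n"
  proof -
    let ?S = "gs_factor e x"
    have "(\<integral>\<^sup>+A. h (A ** ?S) \<partial>\<mu>) = (\<integral>\<^sup>+z. (\<integral>\<^sup>+A. h (A ** ?S) \<partial>\<mu>) \<partial>?Z)"
      by (simp add: Z.emeasure_space_1)
    \<comment> \<open>Left invariance of \<open>\<mu>\<close> inserts the rotation
      \<open>R z\<close>, for almost every \<open>z\<close>.\<close>
    also have "\<dots> = (\<integral>\<^sup>+z. (\<integral>\<^sup>+A. h (R z ** A ** ?S) \<partial>\<mu>) \<partial>?Z)"
    proof (rule nn_integral_cong_AE)
      show "AE z in ?Z. (\<integral>\<^sup>+A. h (A ** ?S) \<partial>\<mu>) = (\<integral>\<^sup>+A. h (R z ** A ** ?S) \<partial>\<mu>)"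
        using Ro by eventually_elim (rule stiefel_haar_left[OF \<mu>, where h="\<lambda>A. h (A ** ?S)", symmetric], auto)
    qed
    also have "\<dots> = (\<integral>\<^sup>+A. (\<integral>\<^sup>+z. h (R z ** A ** ?S) \<partial>?Z) \<partial>\<mu>)"
      by (rule Zmu.Fubini'[symmetric]) measurable
    \<comment> \<open>By transitivity \<open>A\<close> is \<open>U\<close> times the Gram-Schmidt
      frame of \<open>x\<close>. Right invariance of \<open>R\<close> absorbs \<open>U\<close>, and
      frame times factor is \<open>column_matrix x\<close>, so the dependence on \<open>A\<close>
      disappears.\<close>
    also have "\<dots> = (\<integral>\<^sup>+A. (\<integral>\<^sup>+z. h (R z ** column_matrix x) \<partial>?Z) \<partial>\<mu>)"
    proof (rule nn_integral_cong_AE)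
      show "AE A in \<mu>. (\<integral>\<^sup>+z. h (R z ** A ** ?S) \<partial>?Z) = (\<integral>\<^sup>+z. h (R z ** column_matrix x) \<partial>?Z)"
        using st
      proof eventually_elim
        case (elim A)
        obtain U where U: "orthogonal_matrix U" "A = U ** column_matrix (gs_frame e x)"
          using stiefel_transitive[OF card elim gs_frame_stiefel[OF e x]] by blast
        have "R z ** A ** ?S = (R z ** U) ** column_matrix x" for z
          unfolding U(2) by (subst (2) column_matrix_factorization[OF e]) (simp add: matrix_mul_assoc)
        then show ?case
          using Rinv[OF U(1), of "\<lambda>B. h (B ** column_matrix x)"] by simp
      qed
    qed
    also have "\<dots> = (\<integral>\<^sup>+z. h (R z ** column_matrix x) \<partial>?Z)"
      by (simp add: mu.emeasure_space_1)
    finally show ?thesis .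
  qed
  have "AE x in ?G. \<forall>j<CARD('k). gs_residual (\<lambda>i. x (e i)) j \<noteq> 0"
    using e card by (intro gauss_family_residual_nonzero) (auto simp: bij_betw_def)
  then have "(\<integral>\<^sup>+x. (\<integral>\<^sup>+A. h (A ** gs_factor e x) \<partial>\<mu>) \<partial>?G) = (\<integral>\<^sup>+x. (\<integral>\<^sup>+z. h (R z ** column_matrix x) \<partial>?Z) \<partial>?G)"
    by (intro nn_integral_cong_AE) (auto elim!: eventually_mono intro: fixed)
  also have "\<dots> = (\<integral>\<^sup>+z. (\<integral>\<^sup>+x. h (R z ** column_matrix x) \<partial>?G) \<partial>?Z)"
    by (rule ZG.Fubini') measurable
  \<comment> \<open>For fixed \<open>z\<close> the rotation is removed again, this time by the
    invariance of the Gaussian family.\<close>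
  also have "\<dots> = (\<integral>\<^sup>+z. (\<integral>\<^sup>+x. h (column_matrix x) \<partial>?G) \<partial>?Z)"
    by (rule nn_integral_cong_AE) (use Ro in \<open>auto elim!: eventually_mono intro: nn_integral_column_matrix_orthogonal\<close>)
  also have "\<dots> = (\<integral>\<^sup>+x. h (column_matrix x) \<partial>?G)"
    by (simp add: Z.emeasure_space_1)
  finally show ?thesis .
qed

section \<open>Averaging and convexity\<close>

definition signs :: "('k \<Rightarrow> real) set" where "signs = {\<epsilon>. \<forall>a. \<epsilon> a \<in> {-1, 1}}"

lemma finite_signs: "finite (signs :: ('k::finite \<Rightarrow> real) set)"
proof -
  have "signs \<subseteq> Pi\<^sub>E (UNIV :: 'k set) (\<lambda>_. {-1, 1 :: real})" by (auto simp: signs_def PiE_iff)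
  then show ?thesis by (rule finite_subset) (intro finite_PiE, auto)
qed

lemma signs_square: "\<epsilon> \<in> signs \<Longrightarrow> \<epsilon> a * \<epsilon> a = 1"
  by (auto simp: signs_def dest!: spec[of _ a])

text \<open>Flipping the sign at \<open>a\<close> is an involution of \<open>signs\<close> that
  negates every term.\<close>

lemma sum_signs_product:
  fixes a b :: "'k::finite"
  assumes "a \<noteq> b"
  shows "(\<Sum>\<epsilon>\<in>signs. \<epsilon> a * \<epsilon> b) = (0::real)"
proof -
  have "(\<Sum>\<epsilon>\<in>signs. \<epsilon> a * \<epsilon> b) = (\<Sum>\<epsilon>\<in>signs. (\<epsilon>(a := - \<epsilon> a)) a * (\<epsilon>(a := - \<epsilon> a)) b)"
    by (rule sum.reindex_bij_witness[where i="\<lambda>\<epsilon>. \<epsilon>(a := - \<epsilon> a)" and j="\<lambda>\<epsilon>. \<epsilon>(a := - \<epsilon> a)"])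
      (auto simp: signs_def)
  also have "\<dots> = - (\<Sum>\<epsilon>\<in>signs. \<epsilon> a * \<epsilon> b)"
    using assms by (simp add: sum_negf)
  finally show ?thesis by simp
qed

text \<open>Composition with a transposition shows that the sum does not depend on \<open>a\<close>;
  summing over all \<open>a\<close> then gives the same total of \<open>g\<close> for each
  bijection.\<close>

lemma sum_bij_diagonal:
  fixes g :: "'k::finite \<Rightarrow> real" and a :: 'k
  shows "(\<Sum>\<pi> | bij \<pi>. g (\<pi> a)) = real (card {\<pi> :: 'k \<Rightarrow> 'k. bij \<pi>}) * (sum g UNIV / real CARD('k))"
proof -
  define c where "c b = (\<Sum>\<pi> | bij \<pi>. g (\<pi> b))" for b :: 'k
  have eq: "c b = c a" for b
    unfolding c_def
    by (rule sum.reindex_bij_witness[where i="\<lambda>\<pi>. \<pi> \<circ> Transposition.transpose a b" and j="\<lambda>\<pi>. \<pi> \<circ> Transposition.transpose a b"])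
      (auto simp: bij_comp comp_assoc)
  have "real CARD('k) * c a = (\<Sum>b\<in>UNIV. c b)"
  proof -
    have "(\<Sum>b\<in>UNIV. c b) = (\<Sum>b\<in>(UNIV :: 'k set). c a)" by (intro sum.cong refl eq)
    then show ?thesis by simp
  qed
  also have "\<dots> = (\<Sum>\<pi> | bij \<pi>. \<Sum>b\<in>(UNIV :: 'k set). g (\<pi> b))" unfolding c_def by (rule sum.swap)
  also have "\<dots> = (\<Sum>\<pi> | bij (\<pi> :: 'k \<Rightarrow> 'k). sum g UNIV)"
    by (intro sum.cong refl sum.reindex_bij_betw) auto
  finally show ?thesis by (simp add: c_def field_simps)
qed

definition signed_permutation :: "('k \<Rightarrow> real) \<Rightarrow> ('k \<Rightarrow> 'k) \<Rightarrow> real ^ 'k ^ 'k"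
  where "signed_permutation \<epsilon> \<pi> = (\<chi> a b. if b = \<pi> a then \<epsilon> a else 0)"

lemma signed_permutation_conj:
  "(signed_permutation \<epsilon> \<pi> ** S ** transpose (signed_permutation \<epsilon> \<pi>)) $ a $ b = \<epsilon> a * \<epsilon> b * S $ \<pi> a $ \<pi> b"
proof -
  let ?P = "signed_permutation \<epsilon> \<pi>"
  have 1: "(?P ** S) $ a $ c = \<epsilon> a * S $ \<pi> a $ c" for a c
  proof -
    have "(?P ** S) $ a $ c = (\<Sum>d\<in>UNIV. if d = \<pi> a then \<epsilon> a * S $ d $ c else 0)"
      unfolding matrix_matrix_mult_def signed_permutation_def vec_lambda_beta by (rule sum.cong) auto
    then show ?thesis by simp
  qed
  have "(?P ** S ** transpose ?P) $ a $ b = (\<Sum>c\<in>UNIV. (?P ** S) $ a $ c * ?P $ b $ c)"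
    by (simp add: matrix_matrix_mult_def transpose_def)
  also have "\<dots> = (\<Sum>c\<in>UNIV. if c = \<pi> b then \<epsilon> b * (?P ** S) $ a $ c else 0)"
    by (rule sum.cong) (auto simp: signed_permutation_def)
  finally show ?thesis by (simp add: 1)
qed

lemma orthogonal_signed_permutation:
  assumes "\<epsilon> \<in> signs" "bij \<pi>" shows "orthogonal_matrix (signed_permutation \<epsilon> \<pi>)"
proof -
  have "signed_permutation \<epsilon> \<pi> ** mat 1 ** transpose (signed_permutation \<epsilon> \<pi>) = mat 1"
    unfolding vec_eq_iff signed_permutation_conj using assms signs_square[OF assms(1)]
    by (auto simp: mat_def bij_def inj_def)
  then have "signed_permutation \<epsilon> \<pi> ** transpose (signed_permutation \<epsilon> \<pi>) = mat 1" by simp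
  then show ?thesis
    by (metis orthogonal_matrix orthogonal_matrix_transpose transpose_transpose)
qed

text \<open>The signs cancel the entries off the diagonal, and the permutations spread the trace
  evenly along it.\<close>

lemma signed_permutation_average:
  fixes S :: "real ^ 'k ^ 'k"
  shows "(\<Sum>(\<epsilon>, \<pi>)\<in>signs \<times> {\<pi>. bij \<pi>}. signed_permutation \<epsilon> \<pi> ** S ** transpose (signed_permutation \<epsilon> \<pi>))
    = (real (card (signs \<times> {\<pi> :: 'k \<Rightarrow> 'k. bij \<pi>} :: (('k \<Rightarrow> real) \<times> _) set)) * ((\<Sum>a\<in>UNIV. S $ a $ a) / real CARD('k))) *\<^sub>R mat 1"
    (is "?L = ?R")
proof -
  have "?L $ a $ b = ?R $ a $ b" for a b
  proof -
    have "?L $ a $ b = (\<Sum>(\<epsilon>, \<pi>)\<in>signs \<times> {\<pi>. bij \<pi>}. \<epsilon> a * \<epsilon> b * S $ \<pi> a $ \<pi> b)"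
      by (simp add: signed_permutation_conj split_def)
    also have "\<dots> = (\<Sum>\<epsilon>\<in>signs. \<Sum>\<pi> | bij \<pi>. \<epsilon> a * \<epsilon> b * S $ \<pi> a $ \<pi> b)"
      by (rule sum.cartesian_product[symmetric])
    also have "\<dots> = (\<Sum>\<epsilon>\<in>signs. \<epsilon> a * \<epsilon> b) * (\<Sum>\<pi> | bij \<pi>. S $ \<pi> a $ \<pi> b)"
      by (simp add: sum_product)
    also have "\<dots> = ?R $ a $ b"
    proof (cases "a = b")
      case True
      have "(\<Sum>\<epsilon>\<in>signs. \<epsilon> b * \<epsilon> b) = real (card (signs :: ('k \<Rightarrow> real) set))"
        by (simp add: signs_square)
      then show ?thesis using True sum_bij_diagonal[of "\<lambda>a. S $ a $ a" b]
        by (simp add: mat_def card_cartesian_product)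
    qed (simp add: sum_signs_product mat_def)
    finally show ?thesis .
  qed
  then show ?thesis by (simp add: vec_eq_iff)
qed

section \<open>Jensen's inequality in Euclidean spaces\<close>

lemma (in prob_space) expectation_in_closed_convex:
  fixes X :: "'a \<Rightarrow> 'v::euclidean_space"
  assumes C: "closed C" "convex C" and X: "integrable M X" "\<And>\<omega>. X \<omega> \<in> C"
  shows "expectation X \<in> C"
proof (rule ccontr)
  assume "expectation X \<notin> C"
  from separating_hyperplane_closed_point[OF C(2,1) this]
  obtain a b where ab: "a \<bullet> expectation X < b" "\<forall>x\<in>C. b < a \<bullet> x" by blast
  have "b \<le> expectation (\<lambda>\<omega>. a \<bullet> X \<omega>)"
  proof (rule integral_ge_const)
    show "AE \<omega> in M. b \<le> a \<bullet> X \<omega>" using ab(2) X(2) by (simp add: less_imp_le)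
  qed (use X in simp)
  then show False using ab(1) X by simp
qed

text \<open>The pair of \<open>X\<close> and \<open>H (X)\<close> takes values in the epigraph of
  \<open>H\<close>, which is convex, and closed because a finite convex function on a Euclidean
  space is continuous. Hence its mean lies there too. An infinite right side is treated
  separately.\<close>

lemma (in prob_space) jensen_nn_integral:
  fixes X :: "'a \<Rightarrow> 'v::euclidean_space"
  assumes H: "convex_on UNIV H" "\<And>x. 0 \<le> H x" and X: "integrable M X"
  shows "ennreal (H (expectation X)) \<le> (\<integral>\<^sup>+\<omega>. ennreal (H (X \<omega>)) \<partial>M)"
proof (cases "(\<integral>\<^sup>+\<omega>. ennreal (H (X \<omega>)) \<partial>M) = \<infinity>")
  case False
  have cont: "continuous_on UNIV H" by (rule convex_on_continuous[OF open_UNIV H(1)])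
  then have [measurable]: "H \<in> borel_measurable borel" by (rule borel_measurable_continuous_onI)
  have [measurable]: "X \<in> borel_measurable M" using X by auto
  have int: "integrable M (\<lambda>\<omega>. H (X \<omega>))"
    using False H(2) by (intro integrableI_nonneg) (auto simp: less_top)
  have "convex (epigraph UNIV H)" using H(1) by (rule convex_epigraphI)
  moreover have "closed (epigraph UNIV H)"
  proof -
    have "epigraph UNIV H = {p. H (fst p) \<le> snd p}" by (auto simp: epigraph_def)
    then show ?thesis using cont
      by (auto intro!: closed_Collect_le continuous_intros intro: continuous_on_compose2)
  qed
  moreover have "integrable M (\<lambda>\<omega>. (X \<omega>, H (X \<omega>)))"
  proof -
    have "integrable M (\<lambda>\<omega>. (X \<omega>, 0) + (0, H (X \<omega>)))"
      using X int by (intro Bochner_Integration.integrable_add integrable_bounded_linear[OF bounded_linear_Pair[OF bounded_linear_ident bounded_linear_zero]]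
         integrable_bounded_linear[OF bounded_linear_Pair[OF bounded_linear_zero bounded_linear_ident]])
    then show ?thesis by simp
  qed
  note pair = this
  ultimately have "expectation (\<lambda>\<omega>. (X \<omega>, H (X \<omega>))) \<in> epigraph UNIV H"
    by (intro expectation_in_closed_convex) (auto simp: epigraph_def)
  then have "H (expectation X) \<le> expectation (\<lambda>\<omega>. H (X \<omega>))"
    using integral_bounded_linear[OF bounded_linear_fst pair] integral_bounded_linear[OF bounded_linear_snd pair]
    by (simp add: epigraph_def)
  then show ?thesis
    using H(2) int by (subst nn_integral_eq_integral) (auto simp: ennreal_leI)
qed simp

lemma bochner_integral_matrix:
  fixes f :: "'n::finite \<Rightarrow> 'k::finite \<Rightarrow> 'a \<Rightarrow> real"
  assumes "\<And>i j. integrable M (f i j)"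
  shows "integrable M (\<lambda>\<omega>. \<chi> i j. f i j \<omega>)"
    and "(\<integral>\<omega>. (\<chi> i j. f i j \<omega>) \<partial>M) = (\<chi> i j. \<integral>\<omega>. f i j \<omega> \<partial>M)"
proof -
  have eq: "(\<chi> i j. g i j) = (\<Sum>i\<in>UNIV. \<Sum>j\<in>UNIV. g i j *\<^sub>R axis i (axis j 1))" for g :: "'n \<Rightarrow> 'k \<Rightarrow> real"
  proof -
    have "(\<Sum>i\<in>UNIV. \<Sum>j\<in>UNIV. g i j *\<^sub>R (axis i (axis j 1) :: real ^ 'k ^ 'n)) $ a $ b = g a b" for a b
    proof -
      have "(\<Sum>i\<in>UNIV. \<Sum>j\<in>UNIV. g i j *\<^sub>R (axis i (axis j 1) :: real ^ 'k ^ 'n)) $ a $ b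
        = (\<Sum>i\<in>UNIV. \<Sum>j\<in>UNIV. if i = a then if j = b then g i j else 0 else 0)"
        unfolding sum_component by (intro sum.cong refl) (simp add: axis_def)
      also have "\<dots> = (\<Sum>i\<in>UNIV. if i = a then g i b else 0)"
        by (intro sum.cong refl) simp
      finally show ?thesis by simp
    qed
    then show ?thesis by (simp add: vec_eq_iff)
  qed
  show "integrable M (\<lambda>\<omega>. \<chi> i j. f i j \<omega>)"
    unfolding eq using assms by auto
  show "(\<integral>\<omega>. (\<chi> i j. f i j \<omega>) \<partial>M) = (\<chi> i j. \<integral>\<omega>. f i j \<omega> \<partial>M)"
    unfolding eq using assms by simp
qed

section \<open>The comparison for standard Gaussian matrices\<close>

text \<open>The left side is the integral of the square root from \<open>m - 1\<close> to
  \<open>m\<close>, the right side its value at the midpoint: the Hermite-Hadamard inequality for a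
  concave function.\<close>

lemma sqrt_half_ge:
  assumes "1 \<le> (m::real)"
  shows "2/3 * (m * sqrt m - (m - 1) * sqrt (m - 1)) \<le> sqrt (m - 1/2)"
proof -
  define a where "a = sqrt m"
  define b where "b = sqrt (m - 1)"
  have ab: "0 \<le> b" "b < a" "a\<^sup>2 = m" "b\<^sup>2 = m - 1" using assms by (auto simp: a_def b_def)
  have d: "(a - b) * (a + b) = 1" using ab by (simp add: algebra_simps power2_eq_square)
  \<comment> \<open>Here \<open>(a^2 + b^2) / 2 = m - 1/2\<close>. With \<open>p = a^2 + b^2\<close>
    and \<open>q = a * b\<close>, the claim amounts to
    \<open>(p - 2 * q) * (p + 4 * q) \<ge> 0\<close>.\<close>
  have "(2/3 * (a\<^sup>2 + b\<^sup>2 + a * b))\<^sup>2 \<le> (a\<^sup>2 + b\<^sup>2)/2 * (a + b)\<^sup>2"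
  proof -
    define p where "p = a\<^sup>2 + b\<^sup>2"
    define q where "q = a * b"
    have q: "0 \<le> q" "2 * q \<le> p" using ab sum_squares_bound[of a b] by (auto simp: p_def q_def)
    have "(2 * q) * (4 * q) \<le> p * (4 * q)" "(2 * q) * p \<le> p * p" using q by (intro mult_right_mono; simp)+
    then have "8 * (p + q)\<^sup>2 \<le> 9 * p * (p + 2 * q)" by (simp add: power2_eq_square algebra_simps)
    moreover have "(a + b)\<^sup>2 = p + 2 * q" by (simp add: p_def q_def power2_sum)
    ultimately show ?thesis by (simp add: p_def[symmetric] q_def[symmetric] power2_eq_square algebra_simps)
  qed
  then have "(2/3 * (a\<^sup>2 + b\<^sup>2 + a * b))\<^sup>2 * (a - b)\<^sup>2 \<le> (a\<^sup>2 + b\<^sup>2)/2 * (a + b)\<^sup>2 * (a - b)\<^sup>2"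
    by (rule mult_right_mono) simp
  also have "\<dots> = (a\<^sup>2 + b\<^sup>2)/2 * ((a - b) * (a + b))\<^sup>2" by (simp add: power_mult_distrib)
  also have "\<dots> = m - 1/2" unfolding d using ab by (simp add: field_simps)
  also have "(2/3 * (a\<^sup>2 + b\<^sup>2 + a * b))\<^sup>2 * (a - b)\<^sup>2 = (2/3 * ((a\<^sup>2 + b\<^sup>2 + a * b) * (a - b)))\<^sup>2"
    unfolding power_mult_distrib[symmetric] by (simp only: mult.assoc)
  finally have "(2/3 * ((a\<^sup>2 + b\<^sup>2 + a * b) * (a - b)))\<^sup>2 \<le> m - 1/2" .
  then have "2/3 * ((a\<^sup>2 + b\<^sup>2 + a * b) * (a - b)) \<le> sqrt (m - 1/2)"
    by (rule real_le_rsqrt)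
  moreover have "(a\<^sup>2 + b\<^sup>2 + a * b) * (a - b) = a\<^sup>2 * a - b\<^sup>2 * b"
    by (simp add: power2_eq_square algebra_simps)
  ultimately show ?thesis unfolding ab(3,4) by (simp add: a_def b_def)
qed

text \<open>The lower bounds of \<open>sqrt_half_ge\<close> telescope; the smallest argument is
  \<open>m = n - k + 1 \<ge> 1\<close>.\<close>

lemma sum_sqrt_half_ge:
  assumes "k \<le> n"
  shows "2/3 * (real n * sqrt n - real (n - k) * sqrt (real (n - k))) \<le> (\<Sum>i<k. sqrt (real (n - i) - 1/2))"
  using assms
proof (induction k)
  case (Suc k)
  have "2/3 * (real (n - k) * sqrt (real (n - k)) - real (n - Suc k) * sqrt (real (n - Suc k))) \<le> sqrt (real (n - k) - 1/2)"
    using sqrt_half_ge[of "real (n - k)"] Suc.prems by (simp add: of_nat_diff algebra_simps)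
  then show ?case using Suc by simp
qed simp

text \<open>With \<open>t = sqrt (1 - \<rho>)\<close> this reduces to \<open>(1 - t\<^sup>3) * (3 - t\<^sup>2) \<ge> 3 * (1 - t\<^sup>2)\<close> for \<open>0 \<le> t \<le> 1\<close>.\<close>
lemma sum_sqrt_half_bound:
  assumes "1 \<le> k" "k \<le> n" and \<rho>: "real k = \<rho> * real n"
  shows "1 \<le> (1 + \<rho>/2) * (1 / sqrt n) * ((\<Sum>i<k. sqrt (real (n - i) - 1/2)) / k)"
proof -
  have n: "0 < real n" using assms by simp
  have "0 < \<rho> * real n" unfolding \<rho>[symmetric] using assms(1,2) by simp
  then have "0 < \<rho>" using n by (simp add: zero_less_mult_iff)
  moreover have "\<rho> * real n \<le> 1 * real n" unfolding \<rho>[symmetric] using assms(1,2) by simp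
  then have "\<rho> \<le> 1" using n by (rule mult_right_le_imp_le)
  ultimately have r: "0 < \<rho>" "\<rho> \<le> 1" by auto
  define t where "t = sqrt (1 - \<rho>)"
  have t: "0 \<le> t" "t < 1" "t\<^sup>2 = 1 - \<rho>" using r by (auto simp: t_def)
  have nk: "real (n - k) = n * t\<^sup>2" using assms by (simp add: of_nat_diff t algebra_simps)
  then have "sqrt (real (n - k)) = sqrt n * t" using t(1) by (simp only: real_sqrt_mult real_sqrt_abs abs_of_nonneg)
  then have *: "2/3 * (real n * sqrt n - real (n - k) * sqrt (real (n - k))) = 2/3 * real n * sqrt n * (1 - t^3)"
    unfolding nk by (simp add: power3_eq_cube power2_eq_square algebra_simps)
  have key: "3 * (1 - t\<^sup>2) \<le> (1 - t^3) * (3 - t\<^sup>2)"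
  proof -
    have "t * t * t \<le> t * t" "t * t * (t * t) \<le> t * t"
      using t mult_left_mono[of t 1 "t*t"] mult_left_mono[of "t*t" 1 "t*t"] by (auto simp: mult_le_one)
    \<comment> \<open>The difference of the two sides of the claim is
      \<open>t^2 * (1 - t)^2 * (t + 2)\<close>.\<close>
    then have "0 \<le> (1 - t) * (2 * (t * t) - t * t * t - t * t * (t * t))" using t by (intro mult_nonneg_nonneg) auto
    then show ?thesis by (simp add: power2_eq_square power3_eq_cube algebra_simps)
  qed
  \<comment> \<open>Origin of the constant: \<open>3 - t^2 = 2 * (1 + \<rho>/2)\<close>. The factor
    really needed here is \<open>3 * \<rho> / (2 * (1 - t^3))\<close>, which is 3/2 at
    \<open>\<rho> = 1\<close> and tends to 1 as \<open>\<rho>\<close> tends to 0;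
    \<open>1 + \<rho>/2\<close> interpolates linearly between these values.\<close>
  have "1 \<le> (1 - t^3) * (3 - t\<^sup>2) / (3 * \<rho>)" using key r by (simp add: t field_simps)
  also have "\<dots> = (1 + \<rho>/2) * (1 / sqrt n) * (2/3 * real n * sqrt n * (1 - t^3) / k)"
    unfolding \<rho> t using n r by (simp add: field_simps)
  also have "\<dots> \<le> (1 + \<rho>/2) * (1 / sqrt n) * ((\<Sum>i<k. sqrt (real (n - i) - 1/2)) / k)"
    using sum_sqrt_half_ge[OF assms(2)] r n unfolding * by (intro mult_left_mono divide_right_mono) auto
  finally show ?thesis .
qed

lemma matrix_mult_add_left:
  fixes A B :: "real ^ 'k ^ 'n"
  shows "(A + B) ** C = A ** C + B ** C"
  by (simp add: matrix_matrix_mult_def vec_eq_iff sum.distrib distrib_right)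

lemma matrix_mult_sum_right:
  fixes A :: "real ^ 'k ^ 'n"
  shows "A ** (\<Sum>i\<in>I. B i) = (\<Sum>i\<in>I. A ** B i)"
  by (induction I rule: infinite_finite_induct) (auto simp: matrix_add_ldistrib)

text \<open>Conjugating the triangular factor by signed permutations, which leaves both laws invariant,
  averages its expectation to a multiple of the identity.\<close>
lemma stiefel_haar_le_gauss:
  fixes \<mu> :: "(real ^ 'k ^ 'n) measure"
  assumes card: "CARD('k) \<le> CARD('n)" and \<mu>: "stiefel_haar \<mu>"
  obtains \<alpha> where "(\<Sum>i<CARD('k). sqrt (real (CARD('n) - i) - 1/2)) / CARD('k) \<le> \<alpha>"
    and "\<And>H :: real ^ 'k ^ 'n \<Rightarrow> real. convex_on UNIV H \<Longrightarrow> (\<And>A. 0 \<le> H A) \<Longrightarrow>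
      (\<integral>\<^sup>+A. ennreal (H (\<alpha> *\<^sub>R A)) \<partial>\<mu>) \<le> (\<integral>\<^sup>+x. ennreal (H (column_matrix x)) \<partial>gauss_family)"
proof -
  obtain e :: "nat \<Rightarrow> 'k" where e: "bij_betw e {..<CARD('k)} UNIV"
    using ex_bij_betw_nat_finite[of "UNIV :: 'k set"] by (auto simp: atLeast0LessThan)
  then have inj: "inj_on e {..<CARD('k)}" by (simp add: bij_betw_def)
  let ?G = "gauss_family :: ('k \<Rightarrow> real ^ 'n) measure"
  let ?S = "gs_factor e :: ('k \<Rightarrow> real ^ 'n) \<Rightarrow> real ^ 'k ^ 'k"
  note [measurable] = gs_factor_measurable[OF e] gs_frame_measurable[OF e]
  have sets [measurable_cong]: "sets \<mu> = sets borel" and "prob_space \<mu>"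
    using \<mu> by (auto simp: stiefel_haar_def)
  interpret mu: prob_space \<mu> by fact
  interpret G: prob_space ?G by (rule prob_space_gauss_family)
  interpret Gmu: pair_sigma_finite \<mu> ?G by standard
  have S_int: "integrable ?G (\<lambda>x. x b \<bullet> gs_frame e x a)" for a b
  proof (rule Bochner_Integration.integrable_bound[OF integrable_gauss_family[of b]])
    have "norm (x b \<bullet> gs_frame e x a) \<le> norm (x b)" for x :: "'k \<Rightarrow> real ^ 'n"
    proof -
      have "norm (gs_frame e x a) \<le> 1" unfolding gs_frame_def[OF e] norm_gram_schmidt by simp
      then have "norm (x b) * norm (gs_frame e x a) \<le> norm (x b) * 1" by (intro mult_left_mono) auto
      then show ?thesis using Cauchy_Schwarz_ineq2[of "x b" "gs_frame e x a"] by simp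
    qed
    then show "AE x in ?G. norm (x b \<bullet> gs_frame e x a) \<le> norm (norm (x b))" by simp
  qed measurable
  have S_eq: "?S = (\<lambda>x. \<chi> a b. x b \<bullet> gs_frame e x a)" by (simp add: fun_eq_iff gs_factor_def[OF e])
  define E where "E = (\<integral>x. ?S x \<partial>?G)"
  have intS: "integrable ?G ?S" unfolding S_eq using S_int by (rule bochner_integral_matrix)
  have E_entry: "E $ a $ b = (\<integral>x. x b \<bullet> gs_frame e x a \<partial>?G)" for a b
    unfolding E_def S_eq using bochner_integral_matrix(2)[of ?G "\<lambda>a b x. x b \<bullet> gs_frame e x a"] S_int by simp
  define \<alpha> where "\<alpha> = (\<Sum>a\<in>UNIV. E $ a $ a) / CARD('k)"
  show thesis
  proof (rule that[of \<alpha>])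
    have "(\<Sum>i<CARD('k). sqrt (real (CARD('n) - i) - 1/2)) \<le> (\<Sum>i<CARD('k). E $ e i $ e i)"
    proof (rule sum_mono)
      fix i assume "i \<in> {..<CARD('k)}"
      then have i: "i < CARD('k)" by simp
      have "x (e i) \<bullet> gs_frame e x (e i) = norm (gs_residual (\<lambda>i. x (e i)) i)" for x :: "'k \<Rightarrow> real ^ 'n"
        using inner_gram_schmidt_same[of "\<lambda>i. x (e i)" i] i inj by (simp add: gs_frame_def[OF e] inv_into_f_f)
      then show "sqrt (real (CARD('n) - i) - 1/2) \<le> E $ e i $ e i"
        using gauss_family_residual_mean(2)[OF inj i, where 'v="real ^ 'n"] card by (simp add: E_entry)
    qed
    also have "\<dots> = (\<Sum>a\<in>UNIV. E $ a $ a)" by (rule sum.reindex_bij_betw[OF e])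
    finally show "(\<Sum>i<CARD('k). sqrt (real (CARD('n) - i) - 1/2)) / CARD('k) \<le> \<alpha>"
      unfolding \<alpha>_def by (rule divide_right_mono) simp
  next
    fix H :: "real ^ 'k ^ 'n \<Rightarrow> real"
    assume H: "convex_on UNIV H" "\<And>A. 0 \<le> H A"
    have "continuous_on UNIV H" by (rule convex_on_continuous[OF open_UNIV H(1)])
    then have [measurable]: "H \<in> borel_measurable borel" by (rule borel_measurable_continuous_onI)
    let ?I = "(signs :: ('k \<Rightarrow> real) set) \<times> {\<pi> :: 'k \<Rightarrow> 'k. bij \<pi>}"
    define P where "P p = signed_permutation (fst p) (snd p)" for p :: "('k \<Rightarrow> real) \<times> ('k \<Rightarrow> 'k)"
    define N where "N = real (card ?I)"
    have fin: "finite ?I"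
      by (intro finite_cartesian_product finite_signs finite_subset[OF subset_UNIV finite_class.finite_UNIV])
    have "(\<lambda>_. 1, id) \<in> ?I" by (auto simp: signs_def)
    then have N: "0 < N" unfolding N_def using fin by (metis card_gt_0_iff empty_iff of_nat_0_less_iff)
    have avg: "(\<Sum>p\<in>?I. P p ** E ** transpose (P p)) = (N * \<alpha>) *\<^sub>R mat 1"
      using signed_permutation_average[of E] by (simp add: P_def N_def \<alpha>_def split_def)
    \<comment> \<open>Right invariance of \<open>\<mu>\<close> absorbs the left factor
      \<open>P p\<close>; what remains of \<open>A ** ?S x\<close> has the Gaussian law, and
      \<open>transpose (P p)\<close> merely permutes columns and changes their signs.\<close>
    have rot: "(\<integral>\<^sup>+A. (\<integral>\<^sup>+x. ennreal (H (A ** (P p ** ?S x ** transpose (P p)))) \<partial>?G) \<partial>\<mu>)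
        = (\<integral>\<^sup>+x. ennreal (H (column_matrix x)) \<partial>?G)" if p: "p \<in> ?I" for p
    proof -
      obtain \<epsilon> \<pi> where p_eq: "p = (\<epsilon>, \<pi>)" "\<epsilon> \<in> signs" "bij \<pi>" using p by auto
      have orth: "orthogonal_matrix (P p)" unfolding P_def p_eq using p_eq by (simp add: orthogonal_signed_permutation)
      have "(\<integral>\<^sup>+A. (\<integral>\<^sup>+x. ennreal (H (A ** (P p ** ?S x ** transpose (P p)))) \<partial>?G) \<partial>\<mu>)
          = (\<integral>\<^sup>+x. (\<integral>\<^sup>+A. ennreal (H (A ** (P p ** ?S x ** transpose (P p)))) \<partial>\<mu>) \<partial>?G)"
        by (rule Gmu.Fubini'[symmetric]) measurable
      also have "\<dots> = (\<integral>\<^sup>+x. (\<integral>\<^sup>+A. ennreal (H (A ** ?S x ** transpose (P p))) \<partial>\<mu>) \<partial>?G)"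
      proof (rule nn_integral_cong)
        fix x
        show "(\<integral>\<^sup>+A. ennreal (H (A ** (P p ** ?S x ** transpose (P p)))) \<partial>\<mu>) = (\<integral>\<^sup>+A. ennreal (H (A ** ?S x ** transpose (P p))) \<partial>\<mu>)"
          using stiefel_haar_right[OF \<mu> orth, of "\<lambda>A. ennreal (H (A ** ?S x ** transpose (P p)))"]
          by (simp add: matrix_mul_assoc)
      qed
      also have "\<dots> = (\<integral>\<^sup>+x. ennreal (H (column_matrix x ** transpose (P p))) \<partial>?G)"
        by (rule stiefel_haar_times_factor[OF card e \<mu>, of "\<lambda>A. ennreal (H (A ** transpose (P p)))"]) measurable
      also have "\<dots> = (\<integral>\<^sup>+x. ennreal (H (column_matrix (\<lambda>b. \<epsilon> b *\<^sub>R x (\<pi> b)))) \<partial>?G)"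
      proof (rule nn_integral_cong)
        fix x :: "'k \<Rightarrow> real ^ 'n"
        have "(column_matrix x ** transpose (P p)) $ i $ b = column_matrix (\<lambda>b. \<epsilon> b *\<^sub>R x (\<pi> b)) $ i $ b" for i b
        proof -
          have "(column_matrix x ** transpose (P p)) $ i $ b = (\<Sum>c\<in>UNIV. if c = \<pi> b then \<epsilon> b * x c $ i else 0)"
            unfolding matrix_matrix_mult_def column_matrix_def transpose_def P_def p_eq signed_permutation_def
              vec_lambda_beta fst_conv snd_conv by (rule sum.cong) auto
          then show ?thesis by (simp add: column_matrix_def)
        qed
        then have "column_matrix x ** transpose (P p) = column_matrix (\<lambda>b. \<epsilon> b *\<^sub>R x (\<pi> b))" by (simp add: vec_eq_iff)
        then show "ennreal (H (column_matrix x ** transpose (P p))) = ennreal (H (column_matrix (\<lambda>b. \<epsilon> b *\<^sub>R x (\<pi> b))))" by simp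
      qed
      also have "\<dots> = (\<integral>\<^sup>+x. ennreal (H (column_matrix (\<lambda>b. x (\<pi> b)))) \<partial>?G)"
      proof -
        \<comment> \<open>The sign \<open>\<epsilon> b\<close> acts on column
          \<open>\<pi> b\<close>; indexed by the column itself, it is therefore taken at
          \<open>inv \<pi>\<close>.\<close>
        have "orthogonal_transformation (\<lambda>v :: real ^ 'n. \<epsilon> (inv \<pi> b) *\<^sub>R v)" for b
          using signs_square[OF p_eq(2), of "inv \<pi> b"]
          by (auto simp: orthogonal_transformation_def intro!: linearI simp: algebra_simps)
        then have "(\<integral>\<^sup>+x. ennreal (H (column_matrix (\<lambda>b. (\<lambda>c. \<epsilon> (inv \<pi> c) *\<^sub>R x c) (\<pi> b)))) \<partial>?G)
            = (\<integral>\<^sup>+x. ennreal (H (column_matrix (\<lambda>b. x (\<pi> b)))) \<partial>?G)"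
        proof (intro nn_integral_gauss_family_componentwise[where f="\<lambda>x. ennreal (H (column_matrix (\<lambda>b. x (\<pi> b))))"])
          have "(\<lambda>x i. x (\<pi> i)) \<in> measurable ?G ?G" by (rule measurable_PiM_single') (auto simp: space_PiM)
          then show "(\<lambda>x. ennreal (H (column_matrix (\<lambda>b. x (\<pi> b))))) \<in> borel_measurable ?G"
            by (rule measurable_compose) measurable
        qed
        then show ?thesis using p_eq(3) by (simp add: bij_is_inj)
      qed
      also have "\<dots> = (\<integral>\<^sup>+x. ennreal (H (column_matrix x)) \<partial>?G)"
        by (rule nn_integral_gauss_family_permute[OF p_eq(3), of "\<lambda>x. ennreal (H (column_matrix x))"]) measurable
      finally show ?thesis .
    qed
    \<comment> \<open>Convexity is used twice for fixed \<open>A\<close>: over the finite group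
      average, which produces \<open>\<alpha>\<close>, and over the Gaussian family, which replaces
      \<open>E\<close> by \<open>?S x\<close>.\<close>
    have jensen: "ennreal N * ennreal (H (\<alpha> *\<^sub>R A)) \<le> (\<Sum>p\<in>?I. (\<integral>\<^sup>+x. ennreal (H (A ** (P p ** ?S x ** transpose (P p)))) \<partial>?G))" for A
    proof -
      have "\<alpha> *\<^sub>R A = A ** (\<alpha> *\<^sub>R mat 1)" by (simp add: matrix_scalar_ac)
      also have "\<dots> = A ** ((1 / N) *\<^sub>R (\<Sum>p\<in>?I. P p ** E ** transpose (P p)))" using N by (simp add: avg)
      also have "\<dots> = (\<Sum>p\<in>?I. (1 / N) *\<^sub>R (A ** (P p ** E ** transpose (P p))))"
        unfolding matrix_scalar_ac matrix_mult_sum_right scaleR_sum_right scalar_matrix_assoc[symmetric] ..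
      finally have "H (\<alpha> *\<^sub>R A) \<le> (\<Sum>p\<in>?I. 1 / N * H (A ** (P p ** E ** transpose (P p))))"
        using convex_on_sum[OF fin _ H(1), of "\<lambda>_. 1 / N" "\<lambda>p. A ** (P p ** E ** transpose (P p))"] N \<open>(\<lambda>_. 1, id) \<in> ?I\<close>
        by (auto simp: N_def)
      then have "N * H (\<alpha> *\<^sub>R A) \<le> (\<Sum>p\<in>?I. H (A ** (P p ** E ** transpose (P p))))"
        unfolding sum_distrib_left[symmetric] using N by (simp add: divide_simps mult.commute)
      then have "ennreal N * ennreal (H (\<alpha> *\<^sub>R A)) \<le> (\<Sum>p\<in>?I. ennreal (H (A ** (P p ** E ** transpose (P p)))))"
        using N H(2) by (simp flip: ennreal_mult add: ennreal_leI)
      also have "\<dots> \<le> (\<Sum>p\<in>?I. (\<integral>\<^sup>+x. ennreal (H (A ** (P p ** ?S x ** transpose (P p)))) \<partial>?G))"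
      proof (rule sum_mono)
        fix p
        let ?L = "\<lambda>S. A ** (P p ** S ** transpose (P p))"
        have "linear ?L"
          by (intro linearI) (simp_all add: matrix_add_ldistrib matrix_mult_add_left matrix_scalar_ac scalar_matrix_assoc[symmetric])
        then have bl: "bounded_linear ?L" by (simp add: linear_conv_bounded_linear)
        show "ennreal (H (?L E)) \<le> (\<integral>\<^sup>+x. ennreal (H (?L (?S x))) \<partial>?G)"
          using G.jensen_nn_integral[OF H integrable_bounded_linear[OF bl intS]]
          by (simp add: integral_bounded_linear[OF bl intS] E_def)
      qed
      finally show ?thesis .
    qed
    have "(\<lambda>A. \<alpha> *\<^sub>R A) \<in> borel_measurable \<mu>"
      by (intro borel_measurable_scaleR borel_measurable_const measurable_ident_sets[OF sets])
    then have meas: "(\<lambda>A. H (\<alpha> *\<^sub>R A)) \<in> borel_measurable \<mu>"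
      by (rule measurable_compose) measurable
    have "ennreal N * (\<integral>\<^sup>+A. ennreal (H (\<alpha> *\<^sub>R A)) \<partial>\<mu>) = (\<integral>\<^sup>+A. ennreal N * ennreal (H (\<alpha> *\<^sub>R A)) \<partial>\<mu>)"
      by (rule nn_integral_cmult[symmetric]) (rule measurable_compose[OF meas measurable_ennreal])
    also have "\<dots> \<le> (\<integral>\<^sup>+A. (\<Sum>p\<in>?I. (\<integral>\<^sup>+x. ennreal (H (A ** (P p ** ?S x ** transpose (P p)))) \<partial>?G)) \<partial>\<mu>)"
      by (intro nn_integral_mono jensen)
    also have "\<dots> = (\<Sum>p\<in>?I. (\<integral>\<^sup>+A. (\<integral>\<^sup>+x. ennreal (H (A ** (P p ** ?S x ** transpose (P p)))) \<partial>?G) \<partial>\<mu>))"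
      by (intro nn_integral_sum) measurable
    also have "\<dots> = (\<Sum>p\<in>?I. (\<integral>\<^sup>+x. ennreal (H (column_matrix x)) \<partial>?G))" by (intro sum.cong refl rot)
    also have "\<dots> = ennreal N * (\<integral>\<^sup>+x. ennreal (H (column_matrix x)) \<partial>?G)"
      by (simp add: N_def ennreal_of_nat_eq_real_of_nat)
    finally show "(\<integral>\<^sup>+A. ennreal (H (\<alpha> *\<^sub>R A)) \<partial>\<mu>) \<le> (\<integral>\<^sup>+x. ennreal (H (column_matrix x)) \<partial>?G)"
      using N by (simp add: ennreal_mult_le_mult_iff)
  qed
qed

section \<open>The comparison theorem\<close>

text \<open>Grouping the index pairs by their second component makes the columns independent; within
  a column the entries are independent coordinates, standardized by
  \<open>1 / \<sigma>\<close>.\<close>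

lemma (in prob_space) distr_iid_gaussian_columns:
  fixes G :: "'a \<Rightarrow> real ^ 'k ^ 'n"
  assumes \<sigma>: "0 < \<sigma>" and G: "iid_gaussian_matrix M \<sigma> G"
  shows "distr M (\<Pi>\<^sub>M j\<in>UNIV. borel) (\<lambda>\<omega> j. \<chi> i. (1 / \<sigma>) * G \<omega> $ i $ j) = gauss_family"
proof -
  define X where "X j \<omega> = (\<chi> i. (1 / \<sigma>) * G \<omega> $ i $ j)" for j \<omega>
  define Y where "Y p \<omega> = G \<omega> $ fst p $ snd p" for p :: "'n \<times> 'k" and \<omega>
  have ind: "indep_vars (\<lambda>_. borel) Y UNIV"
    using G by (simp add: iid_gaussian_matrix_def Y_def[abs_def] split_def)
  have [measurable]: "Y p \<in> borel_measurable M" for p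
    using ind unfolding indep_vars_def by blast
  have cols: "indep_vars (\<lambda>_. borel) X UNIV"
  proof -
    have "indep_vars (\<lambda>j. PiM (UNIV \<times> {j}) (\<lambda>_. borel)) (\<lambda>j \<omega>. restrict (\<lambda>p. Y p \<omega>) (UNIV \<times> {j})) UNIV"
      by (rule indep_vars_restrict[OF ind]) (auto simp: disjoint_family_on_def)
    then have "indep_vars (\<lambda>_. borel) (\<lambda>j \<omega>. (\<chi> i. (1 / \<sigma>) * restrict (\<lambda>p. Y p \<omega>) (UNIV \<times> {j}) (i, j)) :: real ^ 'n) UNIV"
    proof (rule indep_vars_compose2[where Y="\<lambda>j f. \<chi> i. (1 / \<sigma>) * f (i, j)"])
      fix j :: 'k
      show "(\<lambda>f. (\<chi> i. (1 / \<sigma>) * f (i, j)) :: real ^ 'n) \<in> borel_measurable (PiM (UNIV \<times> {j}) (\<lambda>_. borel))"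
        by (rule borel_measurable_euclidean_space[THEN iffD2])
          (auto simp: Basis_vec_def inner_axis intro!: borel_measurable_times measurable_component_singleton)
    qed
    then show ?thesis by (simp add: X_def[abs_def] Y_def)
  qed
  have col: "distr M borel (X j) = gauss" for j
  proof (rule distr_iid_normal)
    have ax: "b = axis (axis_index b) 1" if "b \<in> Basis" for b :: "real ^ 'n"
      using that by (rule axis_index)
    have Xb: "X j \<omega> \<bullet> b = (1 / \<sigma>) * Y (axis_index b, j) \<omega>" if "b \<in> Basis" for b \<omega>
      by (subst ax[OF that]) (simp add: inner_axis X_def Y_def)
    have "indep_vars (\<lambda>b. PiM {(axis_index b, j)} (\<lambda>_. borel)) (\<lambda>b \<omega>. restrict (\<lambda>p. Y p \<omega>) {(axis_index b, j)}) (Basis :: (real ^ 'n) set)"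
      by (rule indep_vars_restrict[OF ind]) (auto simp: disjoint_family_on_def Basis_vec_def axis_eq_axis)
    then have "indep_vars (\<lambda>_. borel) (\<lambda>b \<omega>. (1 / \<sigma>) * restrict (\<lambda>p. Y p \<omega>) {(axis_index b, j)} (axis_index b, j)) (Basis :: (real ^ 'n) set)"
      by (rule indep_vars_compose2[where Y="\<lambda>b f. (1 / \<sigma>) * f (axis_index b, j)"])
        (auto intro!: borel_measurable_times measurable_component_singleton)
    then show "indep_vars (\<lambda>_. borel) (\<lambda>b \<omega>. X j \<omega> \<bullet> b) Basis"
      by (subst indep_vars_cong[OF refl _ refl]) (auto simp: Xb)
    fix b :: "real ^ 'n" assume b: "b \<in> Basis"
    have "distributed M lborel (\<lambda>\<omega>. G \<omega> $ axis_index b $ j) (normal_density 0 \<sigma>)"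
      using G by (simp add: iid_gaussian_matrix_def)
    then have "distributed M lborel (Y (axis_index b, j)) (normal_density 0 \<sigma>)" by (simp add: Y_def[abs_def])
    from normal_density_affine[OF this \<sigma>, of "1 / \<sigma>" 0]
    have "distributed M lborel (\<lambda>\<omega>. X j \<omega> \<bullet> b) std_normal_density"
      using \<sigma> by (simp add: Xb[OF b])
    then have "distr M lborel (\<lambda>\<omega>. X j \<omega> \<bullet> b) = density lborel std_normal_density"
      by (rule distributed_distr_eq_density)
    then show "distr M borel (\<lambda>\<omega>. X j \<omega> \<bullet> b) = density lborel std_normal_density"
      by (subst (asm) distr_cong[of M M lborel borel]) auto
  qed
  have "distr M (\<Pi>\<^sub>M j\<in>UNIV. borel) (\<lambda>\<omega>. \<lambda>j\<in>UNIV. X j \<omega>) = (\<Pi>\<^sub>M j\<in>UNIV. distr M borel (X j))"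
  proof (rule indep_vars_iff_distr_eq_PiM[THEN iffD1, OF _ _ cols])
    show "X j \<in> borel_measurable M" for j using cols unfolding indep_vars_def by blast
  qed simp
  then have "distr M (\<Pi>\<^sub>M j\<in>UNIV. borel) (\<lambda>\<omega> j. X j \<omega>) = gauss_family" by (simp only: col restrict_UNIV)
  then show ?thesis by (simp only: X_def)
qed

section \<open>Expectations that may be infinite\<close>

lemma (in prob_space) ext_expectation_bounded_below:
  assumes [measurable]: "X \<in> borel_measurable M" and b: "\<And>\<omega>. b \<le> X \<omega>"
  shows "ext_expectation M X = enn2ereal (\<integral>\<^sup>+\<omega>. ennreal (X \<omega> - b) \<partial>M) + ereal b"
proof -
  define p m r where "p = (\<integral>\<^sup>+\<omega>. ennreal (X \<omega>) \<partial>M)" and "m = (\<integral>\<^sup>+\<omega>. ennreal (- X \<omega>) \<partial>M)"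
    and "r = (\<integral>\<^sup>+\<omega>. ennreal (X \<omega> - b) \<partial>M)"
  have "m \<le> (\<integral>\<^sup>+\<omega>. ennreal (- b) \<partial>M)"
    unfolding m_def using b by (intro nn_integral_mono ennreal_leI) simp
  then have m: "m < \<top>" by (simp add: emeasure_space_1 le_less_trans)
  have "p + ennreal (- b) = (\<integral>\<^sup>+\<omega>. ennreal (X \<omega>) + ennreal (- b) \<partial>M)"
    by (simp add: p_def nn_integral_add emeasure_space_1)
  \<comment> \<open>The positive and negative parts are arranged so that only sums occur; the
    identity can then be integrated even if \<open>p\<close> is infinite.\<close>
  also have "\<dots> = (\<integral>\<^sup>+\<omega>. ennreal (X \<omega> - b) + (ennreal b + ennreal (- X \<omega>)) \<partial>M)"
  proof (rule nn_integral_cong)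
    fix \<omega>
    have *: "ennreal x = ennreal (max 0 x)" for x by (simp add: max_def ennreal_neg)
    show "ennreal (X \<omega>) + ennreal (- b) = ennreal (X \<omega> - b) + (ennreal b + ennreal (- X \<omega>))"
      using b[of \<omega>] unfolding *[of "X \<omega>"] *[of "- b"] *[of "X \<omega> - b"] *[of b] *[of "- X \<omega>"]
      by (simp flip: ennreal_plus add: max_def)
  qed
  also have "\<dots> = r + (ennreal b + m)"
    by (simp add: r_def m_def nn_integral_add emeasure_space_1)
  finally have eq: "p + ennreal (- b) = r + (ennreal b + m)" .
  obtain m' where m': "m = ennreal m'" "0 \<le> m'" using m by (cases m) auto
  have "enn2ereal p - enn2ereal m = enn2ereal r + ereal b"
  proof (cases p)
    case (real p')
    then have "r \<noteq> \<top>" using eq by (auto simp: top_add ennreal_add_eq_top)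
    then obtain r' where r': "r = ennreal r'" "0 \<le> r'" by (cases r) auto
    have "p' + max 0 (- b) = r' + (max 0 b + m')"
      using eq real r' m' by (cases "0 \<le> b") (simp_all add: ennreal_neg flip: ennreal_plus)
    then have "p' - m' = r' + b" by (auto simp: max_def split: if_splits)
    then show ?thesis using real r' m' by (simp add: enn2ereal_ennreal)
  next
    case top
    then have "r + (ennreal b + m) = \<top>" using eq by simp
    moreover have "ennreal b + m \<noteq> \<top>" using m by (simp add: less_top ennreal_add_eq_top)
    ultimately have "r = \<top>" by (simp add: ennreal_add_eq_top)
    then show ?thesis using top m' by (simp add: enn2ereal_ennreal)
  qed
  then show ?thesis by (simp add: ext_expectation_def p_def m_def r_def)
qed

lemma ext_expectation_mono:
  assumes "prob_space M" "prob_space M'" "X \<in> borel_measurable M" "Y \<in> borel_measurable M'"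
    and "\<And>\<omega>. b \<le> X \<omega>" "\<And>\<omega>. b \<le> Y \<omega>"
    and "(\<integral>\<^sup>+\<omega>. ennreal (X \<omega> - b) \<partial>M) \<le> (\<integral>\<^sup>+\<omega>. ennreal (Y \<omega> - b) \<partial>M')"
  shows "ext_expectation M X \<le> ext_expectation M' Y"
  using assms(7)
  unfolding prob_space.ext_expectation_bounded_below[OF assms(1,3,5)]
    prob_space.ext_expectation_bounded_below[OF assms(2,4,6)]
  by (intro add_right_mono) (simp add: less_eq_ennreal.rep_eq)

lemma convex_on_mono_compose:
  fixes \<Phi> :: "real \<Rightarrow> real" and f :: "'v::real_vector \<Rightarrow> real"
  assumes "mono \<Phi>" "convex_on UNIV \<Phi>" "convex_on UNIV f"
  shows "convex_on UNIV (\<lambda>x. \<Phi> (f x))"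
proof (rule convex_onI)
  fix t :: real and x y :: 'v assume t: "0 < t" "t < 1"
  have "f ((1 - t) *\<^sub>R x + t *\<^sub>R y) \<le> (1 - t) * f x + t * f y"
    using assms(3) t by (intro convex_onD) auto
  then have "\<Phi> (f ((1 - t) *\<^sub>R x + t *\<^sub>R y)) \<le> \<Phi> ((1 - t) * f x + t * f y)" using assms(1) by (rule monoD[rotated])
  also have "\<dots> \<le> (1 - t) * \<Phi> (f x) + t * \<Phi> (f y)"
    using convex_onD[OF assms(2), of t "f x" "f y"] t by simp
  finally show "\<Phi> (f ((1 - t) *\<^sub>R x + t *\<^sub>R y)) \<le> (1 - t) * \<Phi> (f x) + t * \<Phi> (f y)" .
qed simp

theorem theorem1:
  fixes M :: "'a measure" and Q :: "'a \<Rightarrow> real ^ 'k ^ 'n"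
    and M' :: "'b measure" and G :: "'b \<Rightarrow> real ^ 'k ^ 'n"
    and \<nu> :: "real ^ 'k ^ 'n \<Rightarrow> real" and \<Phi> :: "real \<Rightarrow> real" and \<rho> :: real
  assumes "CARD('k) \<le> CARD('n)"
    and "0 < \<rho>" and "\<rho> \<le> 1" and "real CARD('k) = \<rho> * real CARD('n)"
    and "prob_space M" and "uniform_on_stiefel M Q"
    and "prob_space M'" and "iid_gaussian_matrix M' (sqrt (1 / real CARD('n))) G"
    and "\<And>A. 0 \<le> \<nu> A" and "sublinear_convex \<nu>"
    and "mono \<Phi>" and "convex_on UNIV \<Phi>"
  shows "ext_expectation M (\<lambda>\<omega>. \<Phi> (\<nu> (Q \<omega>)))
           \<le> ext_expectation M' (\<lambda>\<omega>. \<Phi> ((1 + \<rho> / 2) * \<nu> (G \<omega>))) \<and>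
         ext_expectation M (\<lambda>\<omega>. \<Phi> (\<nu> (Q \<omega>)))
           \<le> ext_expectation M' (\<lambda>\<omega>. \<Phi> (1.5 * \<nu> (G \<omega>)))"
proof -
  interpret M: prob_space M by fact
  interpret M': prob_space M' by fact
  define \<sigma> where "\<sigma> = 1 / sqrt (real CARD('n))"
  define c where "c = 1 + \<rho> / 2"
  define \<mu> where "\<mu> = distr M borel Q"
  define X where "X \<omega> = (\<lambda>j. \<chi> i. (1 / \<sigma>) * G \<omega> $ i $ j)" for \<omega>
  have \<sigma>: "0 < \<sigma>" "sqrt (1 / real CARD('n)) = \<sigma>" by (auto simp: \<sigma>_def real_sqrt_divide)
  have c: "1 < c" "c \<le> 3/2" using assms(2,3) by (auto simp: c_def)
  have [measurable]: "Q \<in> borel_measurable M" and haar: "stiefel_haar \<mu>"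
    using assms(6) by (auto simp: uniform_on_stiefel_def \<mu>_def)
  have \<nu>: "convex_on UNIV \<nu>" "\<And>t A. 0 < t \<Longrightarrow> \<nu> (t *\<^sub>R A) = t * \<nu> A"
    using assms(10) by (auto simp: sublinear_convex_def)
  have [measurable]: "\<nu> \<in> borel_measurable borel"
    by (intro borel_measurable_continuous_onI convex_on_continuous \<nu>) simp
  have [measurable]: "\<Phi> \<in> borel_measurable borel" using assms(11) by (rule borel_measurable_mono)
  have [measurable]: "G \<in> borel_measurable M'"
    using assms(8) by (auto simp: borel_measurable_matrix_iff iid_gaussian_matrix_def M'.indep_vars_def)
  have \<Phi>0: "\<Phi> 0 \<le> \<Phi> y" if "0 \<le> y" for y using assms(11) that by (rule monoD)
  obtain \<alpha> where \<alpha>: "(\<Sum>i<CARD('k). sqrt (real (CARD('n) - i) - 1/2)) / CARD('k) \<le> \<alpha>"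
    and le: "\<And>H :: real ^ 'k ^ 'n \<Rightarrow> real. convex_on UNIV H \<Longrightarrow> (\<And>A. 0 \<le> H A) \<Longrightarrow>
      (\<integral>\<^sup>+A. ennreal (H (\<alpha> *\<^sub>R A)) \<partial>\<mu>) \<le> (\<integral>\<^sup>+x. ennreal (H (column_matrix x)) \<partial>gauss_family)"
    using stiefel_haar_le_gauss[OF assms(1) haar] by metis
  have "1 \<le> c * \<sigma> * ((\<Sum>i<CARD('k). sqrt (real (CARD('n) - i) - 1/2)) / CARD('k))"
    unfolding c_def \<sigma>_def using assms(1,4) by (intro sum_sqrt_half_bound) (auto simp: Suc_leI)
  also have "\<dots> \<le> c * \<sigma> * \<alpha>" using \<alpha> c \<sigma> by (intro mult_left_mono) auto
  finally have c\<alpha>: "1 \<le> c * (\<sigma> * \<alpha>)" by (simp add: mult.assoc)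
  \<comment> \<open>Homogeneity of \<open>\<nu>\<close> is available for positive scalars
    only.\<close>
  then have \<sigma>\<alpha>: "0 < \<sigma> * \<alpha>" using c by (metis less_le_trans less_trans zero_less_mult_pos zero_less_one)
  \<comment> \<open>Subtracting \<open>\<Phi> 0\<close> makes \<open>H\<close> nonnegative, because
    \<open>\<nu>\<close> is nonnegative and \<open>\<Phi>\<close> increasing; the factor
    \<open>\<sigma>\<close> returns from standard normal entries to variance
    \<open>1 / n\<close>.\<close>
  define H where "H A = \<Phi> (c * \<nu> (\<sigma> *\<^sub>R A)) - \<Phi> 0" for A
  have H: "convex_on UNIV H" "0 \<le> H A" for A
  proof -
    have "convex_on UNIV (\<lambda>A. c * \<nu> A)" using \<nu>(1) c by (intro convex_on_cmul) auto
    with less_imp_le[OF \<sigma>(1)] have "convex_on UNIV (\<lambda>A. \<sigma> * (c * \<nu> A))" by (rule convex_on_cmul)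
    then have "convex_on UNIV (\<lambda>A. c * \<nu> (\<sigma> *\<^sub>R A))" using \<nu>(2)[OF \<sigma>(1)] by (simp add: mult.left_commute)
    then have "convex_on UNIV (\<lambda>A. \<Phi> (c * \<nu> (\<sigma> *\<^sub>R A)))" by (rule convex_on_mono_compose[OF assms(11,12)])
    from convex_on_add[OF this convex_on_const[THEN iffD2, OF convex_UNIV, of "- \<Phi> 0"]] show "convex_on UNIV H"
      by (simp add: H_def[abs_def])
    show "0 \<le> H A" using \<Phi>0[of "c * \<nu> (\<sigma> *\<^sub>R A)"] assms(9) c by (simp add: H_def)
  qed
  have col: "column_matrix (X \<omega>) = (1 / \<sigma>) *\<^sub>R G \<omega>" for \<omega>
    by (simp add: X_def column_matrix_def vec_eq_iff)
  have law: "distr M' (\<Pi>\<^sub>M j\<in>UNIV. borel) X = gauss_family"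
    using M'.distr_iid_gaussian_columns[OF \<sigma>(1)] assms(8) by (simp add: \<sigma>(2) X_def[abs_def])
  have X [measurable]: "X \<in> measurable M' (\<Pi>\<^sub>M j\<in>UNIV. borel)"
  proof (rule measurable_PiM_single')
    fix j :: 'k
    have "(\<lambda>\<omega>. G \<omega> $ i $ j) \<in> borel_measurable M'" for i
      using \<open>G \<in> borel_measurable M'\<close> by (simp add: borel_measurable_matrix_iff)
    then show "(\<lambda>\<omega>. X \<omega> j) \<in> borel_measurable M'"
      unfolding X_def by (intro borel_measurable_euclidean_space[THEN iffD2])
        (auto simp: Basis_vec_def inner_axis)
  qed (simp add: space_PiM)
  have "(\<integral>\<^sup>+\<omega>. ennreal (\<Phi> (\<nu> (Q \<omega>)) - \<Phi> 0) \<partial>M) = (\<integral>\<^sup>+A. ennreal (\<Phi> (\<nu> A) - \<Phi> 0) \<partial>\<mu>)"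
    unfolding \<mu>_def by (subst nn_integral_distr) auto
  also have "\<dots> \<le> (\<integral>\<^sup>+A. ennreal (H (\<alpha> *\<^sub>R A)) \<partial>\<mu>)"
  proof (intro nn_integral_mono ennreal_leI)
    fix A
    have "1 * \<nu> A \<le> c * (\<sigma> * \<alpha>) * \<nu> A" using c\<alpha> assms(9) by (rule mult_right_mono)
    also have "\<dots> = c * \<nu> (\<sigma> *\<^sub>R (\<alpha> *\<^sub>R A))" using \<nu>(2)[OF \<sigma>\<alpha>] by simp
    finally show "\<Phi> (\<nu> A) - \<Phi> 0 \<le> H (\<alpha> *\<^sub>R A)" using assms(11) by (auto simp: H_def mono_def)
  qed
  also have "\<dots> \<le> (\<integral>\<^sup>+x. ennreal (H (column_matrix x)) \<partial>gauss_family)" by (rule le[OF H])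
  also have "\<dots> = (\<integral>\<^sup>+\<omega>. ennreal (H (column_matrix (X \<omega>))) \<partial>M')"
  proof -
    have "(\<lambda>x. ennreal (H (column_matrix x))) \<in> borel_measurable (gauss_family :: ('k \<Rightarrow> real ^ 'n) measure)"
      unfolding H_def by measurable
    then have "(\<lambda>x. ennreal (H (column_matrix x))) \<in> borel_measurable (distr M' (\<Pi>\<^sub>M j\<in>UNIV. borel) X)"
      unfolding law .
    from nn_integral_distr[OF X, of "\<lambda>x. ennreal (H (column_matrix x))"] this show ?thesis by (simp add: law)
  qed
  also have "\<dots> = (\<integral>\<^sup>+\<omega>. ennreal (\<Phi> (c * \<nu> (G \<omega>)) - \<Phi> 0) \<partial>M')"
    using \<sigma> by (simp add: col H_def)
  finally have main: "(\<integral>\<^sup>+\<omega>. ennreal (\<Phi> (\<nu> (Q \<omega>)) - \<Phi> 0) \<partial>M) \<le> (\<integral>\<^sup>+\<omega>. ennreal (\<Phi> (c * \<nu> (G \<omega>)) - \<Phi> 0) \<partial>M')" .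
  \<comment> \<open>A general \<open>d\<close> covers both claims: \<open>d = c\<close>, and
    \<open>d = 1.5\<close> because \<open>\<rho> \<le> 1\<close>.\<close>
  have "ext_expectation M (\<lambda>\<omega>. \<Phi> (\<nu> (Q \<omega>))) \<le> ext_expectation M' (\<lambda>\<omega>. \<Phi> (d * \<nu> (G \<omega>)))" if d: "c \<le> d" for d
  proof (rule ext_expectation_mono[where b="\<Phi> 0"])
    have "(\<integral>\<^sup>+\<omega>. ennreal (\<Phi> (c * \<nu> (G \<omega>)) - \<Phi> 0) \<partial>M') \<le> (\<integral>\<^sup>+\<omega>. ennreal (\<Phi> (d * \<nu> (G \<omega>)) - \<Phi> 0) \<partial>M')"
      using assms(9) d by (intro nn_integral_mono ennreal_leI diff_right_mono monoD[OF assms(11)] mult_right_mono)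
    with main show "(\<integral>\<^sup>+\<omega>. ennreal (\<Phi> (\<nu> (Q \<omega>)) - \<Phi> 0) \<partial>M) \<le> (\<integral>\<^sup>+\<omega>. ennreal (\<Phi> (d * \<nu> (G \<omega>)) - \<Phi> 0) \<partial>M')"
      by (rule order_trans)
    show "\<Phi> 0 \<le> \<Phi> (\<nu> (Q \<omega>))" for \<omega> by (intro \<Phi>0 assms(9))
    show "\<Phi> 0 \<le> \<Phi> (d * \<nu> (G \<omega>))" for \<omega> using c d by (intro \<Phi>0 mult_nonneg_nonneg assms(9)) simp
    show "(\<lambda>\<omega>. \<Phi> (\<nu> (Q \<omega>))) \<in> borel_measurable M" by measurable
    show "(\<lambda>\<omega>. \<Phi> (d * \<nu> (G \<omega>))) \<in> borel_measurable M'" by measurable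
  qed fact+
  from this[of c] this[of "1.5"] c(2) show ?thesis by (simp add: c_def)
qed

end
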